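(* Let $p\ge 2$ and let $V_0,\dots,V_p$ be complex vector spaces with $\dim V_i=k_i+1$, where $k_0=\sum_{i=1}^p k_i$. Let $A\in \mathbf{P}(V_0\otimes\cdots\otimes V_p)$ (a matrix of boundary format) be such that $\mathrm{Det}\,A\neq 0$. Then $A$ is diagonalizable if and only if $\mathbf{C}^*\subset \mathrm{Stab}(A)$.
   Context: A $(p+1)$-dimensional matrix of boundary format is an element $A\in V_0\otimes\cdots\otimes V_p$ with $\dim V_i=k_i+1$ and $k_0=\sum_{i=1}^pk_i$. The same letter denotes a nonzero tensor and its class in $\mathbf{P}(V_0\otimes\cdots\otimes V_p)$. Given bases $e^{(j)}_0,\dots,e^{(j)}_{k_j}$ of $V_j$, write $A=\sum a_{i_0,\dots,i_p}e^{(0)}_{i_0}\otimes\cdots\otimes e^{(p)}_{i_p}$ (indices $0\le i_j\le k_j$). $\mathrm{Det}$ denotes the hyperdeterminant of Gelfand–Kapranov–Zelevinsky, i.e. the equation of the dual variety (a hypersurface for this format) of the Segre variety $\mathbf{P}(V_0)\times\cdots\times\mathbf{P}(V_p)$. For boundary format, $\mathrm{Det}\,A\ne0$ if and only if there are no nonzero $v_i\in V_i^*$ ($1\le i\le p$) such that the contraction $A(v_1\otimes\cdots\otimes v_p)\in V_0$ vanishes. $A$ is called diagonalizable if there exist bases in the $V_j$ such that $a_{i_0,\dots,i_p}=0$ whenever $i_0\ne\sum_{t=1}^p i_t$. $\mathrm{Stab}(A)\subset SL(V_0)\times\cdots\times SL(V_p)$ is the stabilizer subgroup of the point $A\in\mathbf{P}(V_0\otimes\cdots\otimes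 V_p)$ for the natural action; $\mathbf{C}^*\subset\mathrm{Stab}(A)$ means that $\mathrm{Stab}(A)$ contains a subgroup isomorphic to the algebraic group $\mathbf{C}^*$.
   Formalization: The formal theorem additionally assumes k_0 ≥ 1: if all k_i = 0, every V_i is one-dimensional, A is diagonalizable with Det A ≠ 0, but Stab(A) is trivial and cannot contain C*, so the equivalence fails in that one format. *)

theory Defs
  imports
    "HOL-Library.Poly_Mapping"
    "HOL-Library.FuncSet"
    "HOL-Computational_Algebra.Polynomial"
    "HOL-Computational_Algebra.Factorial_Ring"
    "HOL-Algebra.Product_Groups"
    "Jordan_Normal_Form.Determinant"
    "Jordan_Normal_Form.VS_Connect"
begin

subsection \<open>Polynomials in several variables\<close>

text \<open>A monomial is a finitely supported exponent function on the variables, a polynomial is a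
  finitely supported function from monomials to coefficients. The product provided by
  \<^theory>\<open>HOL-Library.Poly_Mapping\<close> is the usual product of polynomials.\<close>

type_synonym 'v cpoly = "('v \<Rightarrow>\<^sub>0 nat) \<Rightarrow>\<^sub>0 complex"

definition cpoly_vars :: "'v cpoly \<Rightarrow> 'v set" where
  "cpoly_vars P = (\<Union>m\<in>Poly_Mapping.keys P. Poly_Mapping.keys m)"

definition cpoly_eval :: "'v cpoly \<Rightarrow> ('v \<Rightarrow> complex) \<Rightarrow> complex" where
  "cpoly_eval P a = (\<Sum>m\<in>Poly_Mapping.keys P.
     Poly_Mapping.lookup P m * (\<Prod>v\<in>Poly_Mapping.keys m. a v ^ Poly_Mapping.lookup m v))"

definition zariski_closure :: "'v set \<Rightarrow> ('v \<Rightarrow> complex) set \<Rightarrow> ('v \<Rightarrow> complex) set" where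
  "zariski_closure I S =
     {a. (\<forall>v. v \<notin> I \<longrightarrow> a v = 0) \<and>
         (\<forall>P. cpoly_vars P \<subseteq> I \<and> (\<forall>b\<in>S. cpoly_eval P b = 0) \<longrightarrow> cpoly_eval P a = 0)}"


subsection \<open>Multidimensional matrices\<close>

text \<open>The space \<open>V\<^sub>j\<close> (\<open>j \<le> p\<close>) is the standard space \<open>carrier_vec (k j + 1)\<close> over the complex numbers.
  An element of the tensor product of \<open>V\<^sub>0, \<dots>, V\<^sub>p\<close> is given by its coordinates in the standard
  bases; coordinates at arguments that are not multi-indices are zero by convention.\<close>

definition multi_indices :: "nat \<Rightarrow> (nat \<Rightarrow> nat) \<Rightarrow> (nat \<Rightarrow> nat) set" where
  "multi_indices p k = (\<Pi>\<^sub>E j\<in>{..p}. {..k j})"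

type_synonym tensor = "(nat \<Rightarrow> nat) \<Rightarrow> complex"

definition tensors :: "nat \<Rightarrow> (nat \<Rightarrow> nat) \<Rightarrow> tensor set" where
  "tensors p k = {A. \<forall>i. i \<notin> multi_indices p k \<longrightarrow> A i = 0}"

text \<open>The decomposable tensor with factors \<open>x 0, \<dots>, x p\<close>.\<close>

definition pure_tensor :: "nat \<Rightarrow> (nat \<Rightarrow> nat) \<Rightarrow> (nat \<Rightarrow> complex vec) \<Rightarrow> tensor" where
  "pure_tensor p k x = (\<lambda>i. if i \<in> multi_indices p k then \<Prod>j\<le>p. x j $ i j else 0)"

definition is_basis :: "nat \<Rightarrow> (nat \<Rightarrow> complex vec) \<Rightarrow> bool" where
  "is_basis n e \<longleftrightarrow> inj_on e {..<n} \<and>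
     vectorspace.basis (class_ring :: complex ring) (module_vec TYPE(complex) n) (e ` {..<n})"

text \<open>Here \<open>e j i\<close> is the basis vector of index \<open>i\<close> of \<open>V\<^sub>j\<close>, and \<open>a\<close> is the family of coordinates of
  \<open>A\<close> with respect to these bases.\<close>

definition diagonalizable :: "nat \<Rightarrow> (nat \<Rightarrow> nat) \<Rightarrow> tensor \<Rightarrow> bool" where
  "diagonalizable p k A \<longleftrightarrow>
     (\<exists>(e :: nat \<Rightarrow> nat \<Rightarrow> complex vec) (a :: tensor).
        (\<forall>j\<le>p. is_basis (k j + 1) (e j)) \<and>
        A = (\<lambda>r. \<Sum>i\<in>multi_indices p k. a i * pure_tensor p k (\<lambda>j. e j (i j)) r) \<and>
        (\<forall>i\<in>multi_indices p k. i 0 \<noteq> (\<Sum>t=1..p. i t) \<longrightarrow> a i = 0))"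


subsection \<open>The hyperdeterminant\<close>

text \<open>The tensor \<open>A\<close> defines a hyperplane in the tensor product of the dual spaces, and \<open>x j\<close> is a
  vector of the dual of \<open>V\<^sub>j\<close> in the dual basis. The affine tangent space to the cone over the Segre
  variety at \<open>pure_tensor p k x\<close> is spanned by the tensors obtained from it by replacing one of its
  factors by an arbitrary vector. Since the Segre variety is smooth, its dual variety is the closure
  of the set of all hyperplanes that are tangent at some point; we use the cone over it, which
  contains 0.\<close>

definition tensor_pairing :: "nat \<Rightarrow> (nat \<Rightarrow> nat) \<Rightarrow> tensor \<Rightarrow> tensor \<Rightarrow> complex" where
  "tensor_pairing p k A X = (\<Sum>i\<in>multi_indices p k. A i * X i)"

definition tangent_at :: "nat \<Rightarrow> (nat \<Rightarrow> nat) \<Rightarrow> tensor \<Rightarrow> (nat \<Rightarrow> complex vec) \<Rightarrow> bool" where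
  "tangent_at p k A x \<longleftrightarrow>
     (\<forall>j\<le>p. \<forall>y\<in>carrier_vec (k j + 1). tensor_pairing p k A (pure_tensor p k (x(j := y))) = 0)"

definition segre_dual_variety :: "nat \<Rightarrow> (nat \<Rightarrow> nat) \<Rightarrow> tensor set" where
  "segre_dual_variety p k = zariski_closure (multi_indices p k)
     {A \<in> tensors p k. \<exists>x. (\<forall>j\<le>p. x j \<in> carrier_vec (k j + 1) \<and> x j \<noteq> 0\<^sub>v (k j + 1)) \<and>
                            tangent_at p k A x}"

text \<open>The hyperdeterminant is the equation of the dual variety: an irreducible polynomial in the
  coordinates of a tensor whose zero set is the dual variety. It is determined up to a nonzero
  scalar, and it exists whenever the dual variety is a hypersurface, in particular for every
  boundary format.\<close>

definition is_hyperdeterminant :: "nat \<Rightarrow> (nat \<Rightarrow> nat) \<Rightarrow> (nat \<Rightarrow> nat) cpoly \<Rightarrow> bool" where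
  "is_hyperdeterminant p k D \<longleftrightarrow>
     Factorial_Ring.irreducible D \<and> cpoly_vars D \<subseteq> multi_indices p k \<and>
     (\<forall>A\<in>tensors p k. cpoly_eval D A = 0 \<longleftrightarrow> A \<in> segre_dual_variety p k)"


subsection \<open>The stabilizer\<close>

definition SL :: "nat \<Rightarrow> complex mat monoid" where
  "SL n = \<lparr>carrier = {g \<in> carrier_mat n n. det g = 1}, monoid.mult = (*), one = 1\<^sub>m n\<rparr>"

definition SL_product :: "nat \<Rightarrow> (nat \<Rightarrow> nat) \<Rightarrow> (nat \<Rightarrow> complex mat) monoid" where
  "SL_product p k = product_group {..p} (\<lambda>j. SL (k j + 1))"

text \<open>The natural action, which maps \<open>pure_tensor p k x\<close> to \<open>pure_tensor p k (\<lambda>j. g j *\<^sub>v x j)\<close>.\<close>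

definition tensor_act :: "nat \<Rightarrow> (nat \<Rightarrow> nat) \<Rightarrow> (nat \<Rightarrow> complex mat) \<Rightarrow> tensor \<Rightarrow> tensor" where
  "tensor_act p k g A = (\<lambda>i. if i \<in> multi_indices p k
     then \<Sum>l\<in>multi_indices p k. (\<Prod>j\<le>p. g j $$ (i j, l j)) * A l else 0)"

text \<open>The stabilizer of the point of projective space represented by \<open>A\<close>, so \<open>A\<close> is fixed only up to a
  nonzero scalar.\<close>

definition Stab :: "nat \<Rightarrow> (nat \<Rightarrow> nat) \<Rightarrow> tensor \<Rightarrow> (nat \<Rightarrow> complex mat) set" where
  "Stab p k A = {g \<in> carrier (SL_product p k). \<exists>c. c \<noteq> 0 \<and> tensor_act p k g A = (\<lambda>i. c * A i)}"

definition Cstar :: "complex monoid" where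
  "Cstar = \<lparr>carrier = - {0}, monoid.mult = (*), one = 1\<rparr>"

text \<open>\<open>H\<close> contains a subgroup isomorphic to the algebraic group of nonzero complex numbers: there is a
  group homomorphism \<open>\<phi>\<close> into \<open>H\<close> which is an isomorphism of algebraic varieties onto its image.
  Regular functions on the punctured line are Laurent polynomials, and regular functions on a closed
  subvariety of the product of the special linear groups are restrictions of polynomials in the
  matrix entries; the variable \<open>(j, r, c)\<close> stands for the entry in row \<open>r\<close> and column \<open>c\<close> of the
  factor \<open>j\<close>. Closedness of the image need not be required: it holds for every homomorphism of
  algebraic groups.\<close>

definition contains_Cstar ::
    "nat \<Rightarrow> (nat \<Rightarrow> nat) \<Rightarrow> (nat \<Rightarrow> complex mat) set \<Rightarrow> bool" where
  "contains_Cstar p k H \<longleftrightarrow>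
     (\<exists>\<phi> \<in> hom Cstar (SL_product p k).
        \<phi> ` carrier Cstar \<subseteq> H \<and>
        (\<forall>j\<le>p. \<forall>r\<le>k j. \<forall>c\<le>k j. \<exists>(q :: complex poly) (N :: nat).
           \<forall>t\<in>carrier Cstar. \<phi> t j $$ (r, c) = poly q t / t ^ N) \<and>
        (\<exists>P :: (nat \<times> nat \<times> nat) cpoly.
           cpoly_vars P \<subseteq> {(j, r, c). j \<le> p \<and> r \<le> k j \<and> c \<le> k j} \<and>
           (\<forall>t\<in>carrier Cstar. cpoly_eval P (\<lambda>(j, r, c). \<phi> t j $$ (r, c)) = t)))"

end

theory Submission
  imports Defs "Jordan_Normal_Form.DL_Rank"
begin

text \<open>
  In suitable bases a torus in the stabilizer acts diagonally, and the tensor satisfies a linear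
  condition on its support: there are integers \<open>w\<^sub>j(l)\<close>, and numbers \<open>U(l)\<close> obtained from the weights on
  \<open>V\<^sub>0\<close> by a change of sign and a shift, such that \<open>U(i\<^sub>0) = w\<^sub>1(i\<^sub>1) + \<dots> + w\<^sub>p(i\<^sub>p)\<close> whenever the
  coordinate of \<open>A\<close> at \<open>(i\<^sub>0, \<dots>, i\<^sub>p)\<close> is nonzero. Let the bases be ordered so that \<open>U\<close> and the \<open>w\<^sub>j\<close>
  are increasing. The heart of the proof is that a nonzero hyperdeterminant forces
  \<open>U(\<beta>\<^sub>1 + \<dots> + \<beta>\<^sub>p) = w\<^sub>1(\<beta>\<^sub>1) + \<dots> + w\<^sub>p(\<beta>\<^sub>p)\<close> for all \<open>\<beta>\<close> (\<open>weights_additive\<close>). Put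
  \<open>m = \<beta>\<^sub>1 + \<dots> + \<beta>\<^sub>p\<close>. If the left side were the larger one, then all coordinates with \<open>i\<^sub>0 \<ge> m\<close> and
  \<open>i\<^sub>j \<le> \<beta>\<^sub>j\<close> would vanish. The product of the projective spaces on the first \<open>\<beta>\<^sub>j + 1\<close> basis vectors has
  dimension \<open>m\<close>, and only \<open>m\<close> of the multilinear forms that make up \<open>A\<close> would be nonzero on it. They
  would have a common zero, and \<open>A\<close> would be degenerate. The other inequality is symmetric.

  If at least two of \<open>k\<^sub>1, \<dots>, k\<^sub>p\<close> are positive, then additivity makes every weight sequence an
  arithmetic progression, all with the same difference \<open>d\<close> (\<open>additive_weights_affine\<close>). Since the
  torus acts faithfully and with determinant 1, \<open>d \<noteq> 0\<close>; the condition on the support becomes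
  \<open>i\<^sub>0 = i\<^sub>1 + \<dots> + i\<^sub>p\<close>, which is diagonality. If only one \<open>k\<^sub>j\<close> is positive, then \<open>A\<close> is an invertible
  square matrix, and every such matrix is diagonal in suitable bases
  (\<open>single_factor_diagonalizable\<close>).

  The existence of the common zero is a statement of intersection theory. Since the dual variety is
  defined as a Zariski closure, an approximate version suffices
  (\<open>zero_block_in_segre_dual_variety\<close>). The forms of \<open>A\<close> are joined by a line to the coordinate
  functions of an affine chart, whose zero at the origin is transversal. A fixed point iteration
  yields a zero of the general member of this line as a formal power series in the parameter of the
  line. Truncating the series and correcting one coefficient of each form gives degenerate tensors
  that agree with the line to any prescribed order. A polynomial that vanishes on all degenerate
  tensors vanishes along the line to infinite order at the starting point, hence identically, and so
  it vanishes at \<open>A\<close>.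

  Conversely, a diagonal tensor is fixed by the matrices with diagonal entries \<open>t\<^bsup>2l - k\<^esup>\<close>, where
  \<open>k = k\<^sub>j\<close>, on \<open>V\<^sub>j\<close> for \<open>j \<ge> 1\<close>, and by the inverse exponents on \<open>V\<^sub>0\<close>. If all \<open>k\<^sub>j\<close> are even, the
  exponents are halved. Then the exponent 1 occurs, so that \<open>t\<close> is a polynomial in the matrix entries.
\<close>

section \<open>Bases and the action of matrices on tensors\<close>

definition frame_mat :: "nat \<Rightarrow> (nat \<Rightarrow> complex vec) \<Rightarrow> complex mat" where
  "frame_mat n e = mat n n (\<lambda>(r, c). e c $ r)"

lemma frame_mat_carrier [simp]: "frame_mat n e \<in> carrier_mat n n"
  by (simp add: frame_mat_def)

lemma frame_mat_index [simp]: "r < n \<Longrightarrow> c < n \<Longrightarrow> frame_mat n e $$ (r, c) = e c $ r"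
  by (simp add: frame_mat_def)

text \<open>
  Determinants are the convenient form of the basis property: an inverse matrix and the ability to
  test linear independence follow from it directly.
\<close>

lemma is_basis_iff_det:
  "is_basis n e \<longleftrightarrow> e ` {..<n} \<subseteq> carrier_vec n \<and> det (frame_mat n e) \<noteq> 0"
proof -
  interpret vec_space "TYPE(complex)" n .
  have cols: "cols (frame_mat n e) = map e [0..<n]" if "e ` {..<n} \<subseteq> carrier_vec n"
    using that by (intro nth_equalityI) (auto simp: cols_def frame_mat_def intro!: eq_vecI)
  show ?thesis
  proof
    assume b: "is_basis n e"
    then have car: "e ` {..<n} \<subseteq> carrier_vec n" and li: "lin_indpt (e ` {..<n})"
      and inj: "inj_on e {..<n}"
      by (auto simp: is_basis_def basis_def)
    have "rank (frame_mat n e) = n"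
      using li inj by (intro lin_indpt_full_rank) (auto simp: cols[OF car] distinct_map lessThan_atLeast0)
    then show "e ` {..<n} \<subseteq> carrier_vec n \<and> det (frame_mat n e) \<noteq> 0"
      using car det_rank_iff[of "frame_mat n e"] by simp
  next
    assume *: "e ` {..<n} \<subseteq> carrier_vec n \<and> det (frame_mat n e) \<noteq> 0"
    then have car: "e ` {..<n} \<subseteq> carrier_vec n" and rk: "rank (frame_mat n e) = n"
      using det_rank_iff[of "frame_mat n e"] by auto
    have dist: "distinct (cols (frame_mat n e))"
      using non_distinct_low_rank[of "frame_mat n e"] rk by auto
    have inj: "inj_on e {..<n}"
      using dist by (auto simp: cols[OF car] distinct_map lessThan_atLeast0)
    have li: "lin_indpt (e ` {..<n})"
      using full_rank_lin_indpt[OF frame_mat_carrier rk dist] by (simp add: cols[OF car] lessThan_atLeast0)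
    have "basis (e ` {..<n})"
      using car li by (intro dim_li_is_basis) (auto simp: dim_is_n card_image[OF inj])
    then show "is_basis n e"
      using inj by (simp add: is_basis_def)
  qed
qed

lemma inverse_of_frame:
  assumes "is_basis n e"
  obtains F where "F \<in> carrier_mat n n" "F * frame_mat n e = 1\<^sub>m n" "frame_mat n e * F = 1\<^sub>m n"
proof -
  have "frame_mat n e \<in> Units (ring_mat TYPE(complex) n undefined)"
    using assms by (intro det_non_zero_imp_unit) (auto simp: is_basis_iff_det)
  then show ?thesis
    using that by (auto simp: Units_def ring_mat_def)
qed

lemma mat_mult_index_sum:
  assumes "M \<in> carrier_mat n n" "N \<in> carrier_mat n n" "r < n" "c < n"
  shows "(M * N) $$ (r, c) = (\<Sum>l<n. M $$ (r, l) * N $$ (l, c))"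
  using assms by (simp add: scalar_prod_def lessThan_atLeast0)

text \<open>
  The system is padded with zero rows to a square matrix, which is then singular.
\<close>

lemma homogeneous_system_nonzero_solution:
  fixes L :: "'a \<Rightarrow> nat \<Rightarrow> complex"
  assumes "finite K" "card K < n"
  obtains v where "v \<in> carrier_vec n" "v \<noteq> 0\<^sub>v n" "\<And>q. q \<in> K \<Longrightarrow> (\<Sum>r<n. L q r * v $ r) = 0"
proof -
  obtain h where h: "bij_betw h {0..<card K} K"
    using ex_bij_betw_nat_finite[OF assms(1)] by auto
  define M where "M = mat\<^sub>r n n (\<lambda>i. if i = card K then 0\<^sub>v n else if i < card K then vec n (L (h i)) else 0\<^sub>v n)"
  have M: "M \<in> carrier_mat n n"
    by (simp add: M_def)
  have "det M = 0"
    unfolding M_def by (rule det_row_0) (use assms(2) in auto)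
  then obtain v where v: "v \<in> carrier_vec n" "v \<noteq> 0\<^sub>v n" "M *\<^sub>v v = 0\<^sub>v n"
    using det_0_iff_vec_prod_zero[OF M] by auto
  show ?thesis
  proof (rule that[OF v(1,2)])
    fix q assume "q \<in> K"
    then obtain i where i: "i < card K" "q = h i"
      using h unfolding bij_betw_def by (metis atLeastLessThan_iff imageE)
    have "(M *\<^sub>v v) $ i = 0"
      using v(3) i assms(2) by simp
    moreover have "row M i = vec n (L q)"
      using i assms(2) by (simp add: M_def)
    ultimately show "(\<Sum>r<n. L q r * v $ r) = 0"
      using i assms(2) v(1) M by (simp add: scalar_prod_def lessThan_atLeast0)
  qed
qed

lemma atMost_eq_insert_0: "{..p} = insert (0::nat) {1..p}"
  by auto

lemma finite_multi_indices [simp, intro]: "finite (multi_indices p k)"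
  by (auto simp: multi_indices_def intro!: finite_PiE)

lemma multi_indices_le: "i \<in> multi_indices p k \<Longrightarrow> j \<le> p \<Longrightarrow> i j \<le> k j"
  by (auto simp: multi_indices_def)

lemma sum_multi_indices_prod:
  fixes f :: "nat \<Rightarrow> nat \<Rightarrow> 'a :: comm_semiring_1"
  shows "(\<Sum>i\<in>multi_indices p k. \<Prod>j\<le>p. f j (i j)) = (\<Prod>j\<le>p. \<Sum>l\<le>k j. f j l)"
  unfolding multi_indices_def by (subst prod_sum_PiE) auto

text \<open>
  Passing from coordinates in arbitrary bases to standard coordinates is the action of the matrices
  whose columns are the basis vectors. All changes of bases below are expressed through this action.
\<close>

lemma expansion_eq_tensor_act:
  "(\<lambda>r. \<Sum>i\<in>multi_indices p k. a i * pure_tensor p k (\<lambda>j. e j (i j)) r) =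
     tensor_act p k (\<lambda>j. frame_mat (k j + 1) (e j)) a"
  by (auto simp: fun_eq_iff tensor_act_def pure_tensor_def multi_indices_le less_Suc_eq_le mult.commute
      intro!: sum.cong prod.cong)

lemma tensor_act_cong:
  assumes "\<And>j. j \<le> p \<Longrightarrow> g j = h j"
  shows "tensor_act p k g A = tensor_act p k h A"
  unfolding tensor_act_def using assms by (intro ext if_cong sum.cong prod.cong arg_cong2[of _ _ _ _ "(*)"]) auto

lemma tensor_act_mult:
  assumes "\<And>j. j \<le> p \<Longrightarrow> g j \<in> carrier_mat (k j + 1) (k j + 1)"
    and "\<And>j. j \<le> p \<Longrightarrow> h j \<in> carrier_mat (k j + 1) (k j + 1)"
  shows "tensor_act p k g (tensor_act p k h A) = tensor_act p k (\<lambda>j. g j * h j) A"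
proof
  fix i
  show "tensor_act p k g (tensor_act p k h A) i = tensor_act p k (\<lambda>j. g j * h j) A i"
  proof (cases "i \<in> multi_indices p k")
    case True
    have "tensor_act p k g (tensor_act p k h A) i =
        (\<Sum>l\<in>multi_indices p k. \<Sum>m\<in>multi_indices p k. (\<Prod>j\<le>p. g j $$ (i j, l j) * h j $$ (l j, m j)) * A m)"
      using True by (simp add: tensor_act_def sum_distrib_left prod.distrib mult.assoc)
    also have "\<dots> = (\<Sum>m\<in>multi_indices p k. (\<Sum>l\<in>multi_indices p k. \<Prod>j\<le>p. g j $$ (i j, l j) * h j $$ (l j, m j)) * A m)"
      by (subst sum.swap) (simp add: sum_distrib_right)
    also have "\<dots> = (\<Sum>m\<in>multi_indices p k. (\<Prod>j\<le>p. (g j * h j) $$ (i j, m j)) * A m)"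
    proof (intro sum.cong refl arg_cong2[of _ _ _ _ "(*)"])
      fix m assume m: "m \<in> multi_indices p k"
      have "(g j * h j) $$ (i j, m j) = (\<Sum>l\<le>k j. g j $$ (i j, l) * h j $$ (l, m j))" if "j \<le> p" for j
        using assms[OF that] multi_indices_le[OF True that] multi_indices_le[OF m that]
        by (auto simp: scalar_prod_def lessThan_Suc_atMost[symmetric] lessThan_atLeast0)
      then show "(\<Sum>l\<in>multi_indices p k. \<Prod>j\<le>p. g j $$ (i j, l j) * h j $$ (l j, m j)) =
          (\<Prod>j\<le>p. (g j * h j) $$ (i j, m j))"
        by (subst sum_multi_indices_prod) (auto intro!: prod.cong)
    qed
    finally show ?thesis
      using True by (simp add: tensor_act_def)
  qed (simp add: tensor_act_def)
qed

lemma tensor_act_diagonal: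
  assumes "i \<in> multi_indices p k"
    and "\<And>j r c. j \<le> p \<Longrightarrow> r \<le> k j \<Longrightarrow> c \<le> k j \<Longrightarrow> g j $$ (r, c) = (if r = c then d j r else 0)"
  shows "tensor_act p k g A i = (\<Prod>j\<le>p. d j (i j)) * A i"
proof -
  have "(\<Prod>j\<le>p. g j $$ (i j, l j)) = (if l = i then \<Prod>j\<le>p. d j (i j) else 0)"
    if l: "l \<in> multi_indices p k" for l
  proof (cases "l = i")
    case True
    then show ?thesis
      using assms by (auto intro!: prod.cong simp: multi_indices_le)
  next
    case False
    then obtain j where "j \<le> p" "l j \<noteq> i j"
      using l assms(1) unfolding multi_indices_def by (metis PiE_ext atMost_iff)
    then have "g j $$ (i j, l j) = 0"
      using assms multi_indices_le[OF l] multi_indices_le[OF assms(1)] by auto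
    then show ?thesis
      using False \<open>j \<le> p\<close> by (auto intro!: prod_zero)
  qed
  then have "(\<Prod>j\<le>p. g j $$ (i j, l j)) * A l = (if l = i then (\<Prod>j\<le>p. d j (i j)) * A i else 0)"
    if "l \<in> multi_indices p k" for l
    using that by simp
  then have "tensor_act p k g A i = (\<Sum>l\<in>multi_indices p k. if l = i then (\<Prod>j\<le>p. d j (i j)) * A i else 0)"
    using assms(1) unfolding tensor_act_def by simp
  then show ?thesis
    using assms(1) by simp
qed

lemma tensor_act_one:
  assumes "A \<in> tensors p k"
  shows "tensor_act p k (\<lambda>j. 1\<^sub>m (k j + 1)) A = A"
proof
  fix i show "tensor_act p k (\<lambda>j. 1\<^sub>m (k j + 1)) A i = A i"
  proof (cases "i \<in> multi_indices p k")
    case True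
    then show ?thesis
      by (subst tensor_act_diagonal[where d = "\<lambda>_ _. 1"]) auto
  qed (use assms in \<open>auto simp: tensor_act_def tensors_def\<close>)
qed

lemma tensor_act_in_tensors [simp]: "tensor_act p k g A \<in> tensors p k"
  by (simp add: tensors_def tensor_act_def)

section \<open>Contractions and tangent hyperplanes\<close>

lemma tensor_pairing_pure:
  "tensor_pairing p k A (pure_tensor p k x) = (\<Sum>i\<in>multi_indices p k. A i * (\<Prod>j\<le>p. x j $ i j))"
  by (simp add: tensor_pairing_def pure_tensor_def)

lemma prod_fun_upd_split:
  fixes f :: "nat \<Rightarrow> 'b \<Rightarrow> 'c :: comm_monoid_mult"
  assumes "j \<le> p"
  shows "(\<Prod>j'\<le>p. f j' ((x(j := y)) j')) = f j y * (\<Prod>j'\<in>{..p} - {j}. f j' (x j'))"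
proof -
  have "(\<Prod>j'\<le>p. f j' ((x(j := y)) j')) = f j ((x(j := y)) j) * (\<Prod>j'\<in>{..p} - {j}. f j' ((x(j := y)) j'))"
    using assms by (intro prod.remove) auto
  then show ?thesis
    by simp
qed

lemma tensor_pairing_expand:
  assumes "j \<le> p" "y \<in> carrier_vec (k j + 1)"
  shows "tensor_pairing p k A (pure_tensor p k (x(j := y))) =
    (\<Sum>l\<le>k j. y $ l * tensor_pairing p k A (pure_tensor p k (x(j := unit_vec (k j + 1) l))))"
proof -
  have e: "y $ i j = (\<Sum>l\<le>k j. y $ l * unit_vec (k j + 1) l $ i j)" if "i \<in> multi_indices p k" for i
  proof -
    have "(\<Sum>l\<le>k j. y $ l * unit_vec (k j + 1) l $ i j) = (\<Sum>l\<le>k j. if l = i j then y $ l else 0)"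
      using multi_indices_le[OF that assms(1)] by (intro sum.cong) auto
    then show ?thesis
      using multi_indices_le[OF that assms(1)] by simp
  qed
  have "tensor_pairing p k A (pure_tensor p k (x(j := y))) =
     (\<Sum>i\<in>multi_indices p k. A i * (y $ i j * (\<Prod>j'\<in>{..p} - {j}. x j' $ i j')))"
    unfolding tensor_pairing_pure using prod_fun_upd_split[OF assms(1), of "\<lambda>j' v. v $ i j'" x y for i] by simp
  also have "\<dots> = (\<Sum>i\<in>multi_indices p k. \<Sum>l\<le>k j. y $ l * (A i * (unit_vec (k j + 1) l $ i j * (\<Prod>j'\<in>{..p} - {j}. x j' $ i j'))))"
    by (intro sum.cong refl, subst e) (auto simp: sum_distrib_left sum_distrib_right ac_simps)
  also have "\<dots> = (\<Sum>l\<le>k j. y $ l * (\<Sum>i\<in>multi_indices p k. A i * (unit_vec (k j + 1) l $ i j * (\<Prod>j'\<in>{..p} - {j}. x j' $ i j'))))"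
    by (subst sum.swap) (simp add: sum_distrib_left)
  also have "\<dots> = (\<Sum>l\<le>k j. y $ l * tensor_pairing p k A (pure_tensor p k (x(j := unit_vec (k j + 1) l))))"
    unfolding tensor_pairing_pure using prod_fun_upd_split[OF assms(1), of "\<lambda>j' v. v $ i j'" x "unit_vec (k j + 1) l" for i l] by simp
  finally show ?thesis .
qed

text \<open>
  The component of index \<open>r\<close> of the vector in \<open>V\<^sub>0\<close> that arises by inserting \<open>X 1, \<dots>, X p\<close> into the
  tensor \<open>a\<close>. The coefficients range over a commutative ring because the definition is used for
  complex numbers and for polynomials in the parameter of a curve of tensors.
\<close>

definition contraction :: "nat \<Rightarrow> (nat \<Rightarrow> nat) \<Rightarrow> ((nat \<Rightarrow> nat) \<Rightarrow> 'a :: comm_ring_1) \<Rightarrow> (nat \<Rightarrow> nat \<Rightarrow> 'a) \<Rightarrow> nat \<Rightarrow> 'a" where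
  "contraction p k a X r = (\<Sum>i | i \<in> multi_indices p k \<and> i 0 = r. a i * (\<Prod>j=1..p. X j (i j)))"

lemma contraction_eq_pairing:
  assumes "r \<le> k 0"
  shows "contraction p k A (\<lambda>j l. x j $ l) r =
    tensor_pairing p k A (pure_tensor p k (x(0 := unit_vec (k 0 + 1) r)))"
proof -
  have "tensor_pairing p k A (pure_tensor p k (x(0 := unit_vec (k 0 + 1) r))) =
     (\<Sum>i\<in>multi_indices p k. if i 0 = r then A i * (\<Prod>j=1..p. x j $ i j) else 0)"
    unfolding tensor_pairing_pure
  proof (intro sum.cong refl)
    fix i assume "i \<in> multi_indices p k"
    then have "i 0 \<le> k 0"
      by (simp add: multi_indices_le)
    have "(\<Prod>j=1..p. (x(0 := unit_vec (k 0 + 1) r)) j $ i j) = (\<Prod>j=1..p. x j $ i j)"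
      by (intro prod.cong) auto
    then show "A i * (\<Prod>j\<le>p. (x(0 := unit_vec (k 0 + 1) r)) j $ i j) =
         (if i 0 = r then A i * (\<Prod>j=1..p. x j $ i j) else 0)"
      using \<open>i 0 \<le> k 0\<close> assms unfolding atMost_eq_insert_0 by (subst prod.insert) auto
  qed
  then show ?thesis
    by (simp add: contraction_def sum.inter_filter[symmetric])
qed

text \<open>
  A zero of the contraction is a point at which the hyperplane is tangent, for a suitable factor \<open>z\<close> in
  \<open>V\<^sub>0\<close>. In each slot \<open>j \<ge> 1\<close> the pairing has to vanish on \<open>V\<^sub>j\<close>; it already vanishes at \<open>x j\<close>, so \<open>k j\<close>
  conditions remain. In boundary format these are \<open>k 0\<close> linear conditions on a vector with \<open>k 0 + 1\<close>
  entries.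
\<close>

lemma contraction_zero_imp_tangent:
  assumes k0: "k 0 = (\<Sum>i=1..p. k i)"
    and x: "\<And>j. j \<in> {1..p} \<Longrightarrow> x j \<in> carrier_vec (k j + 1) \<and> x j \<noteq> 0\<^sub>v (k j + 1)"
    and zero: "\<And>r. r \<le> k 0 \<Longrightarrow> contraction p k A (\<lambda>j l. x j $ l) r = 0"
  obtains z where "z \<in> carrier_vec (k 0 + 1)" "z \<noteq> 0\<^sub>v (k 0 + 1)" "tangent_at p k A (x(0 := z))"
proof -
  have "\<exists>q\<le>k j. x j $ q \<noteq> 0" if "j \<in> {1..p}" for j
  proof (rule ccontr)
    assume "\<not> ?thesis"
    then have "x j = 0\<^sub>v (k j + 1)"
      using x[OF that] by (intro eq_vecI) auto
    then show False
      using x[OF that] by simp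
  qed
  then obtain q where q: "\<And>j. j \<in> {1..p} \<Longrightarrow> q j \<le> k j \<and> x j $ q j \<noteq> 0"
    by metis
  \<comment> \<open>The unit vectors other than the pivot one span, together with \<open>x j\<close>, the space \<open>V\<^sub>j\<close>.\<close>
  define T where "T = (SIGMA j:{1..p}. {..k j} - {q j})"
  have "card T = (\<Sum>j=1..p. card ({..k j} - {q j}))"
    unfolding T_def by (intro card_SigmaI) auto
  also have "\<dots> = (\<Sum>j=1..p. k j)"
    using q by (intro sum.cong) auto
  finally have cardT: "finite T" "card T < k 0 + 1"
    using k0 by (auto simp: T_def)
  define form where "form = (\<lambda>u. tensor_pairing p k A (pure_tensor p k u))"
  have expand: "form (u(j := y)) = (\<Sum>l\<le>k j. y $ l * form (u(j := unit_vec (k j + 1) l)))"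
    if "j \<le> p" "y \<in> carrier_vec (k j + 1)" for u j y
    unfolding form_def using that by (rule tensor_pairing_expand)
  define L where "L = (\<lambda>(j, l) r. form (x(j := unit_vec (k j + 1) l, 0 := unit_vec (k 0 + 1) r)))"
  obtain z where z: "z \<in> carrier_vec (k 0 + 1)" "z \<noteq> 0\<^sub>v (k 0 + 1)"
    and Lz: "\<And>t. t \<in> T \<Longrightarrow> (\<Sum>r<k 0 + 1. L t r * z $ r) = 0"
    by (rule homogeneous_system_nonzero_solution[OF cardT, where L = L]) blast
  have form0: "form (x(0 := y)) = 0" if "y \<in> carrier_vec (k 0 + 1)" for y
  proof -
    have "form (x(0 := unit_vec (k 0 + 1) l)) = 0" if "l \<le> k 0" for l
      using zero[OF that] that by (simp add: form_def contraction_eq_pairing)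
    then show ?thesis
      using expand[of 0 y x] that by simp
  qed
  have off: "form (x(0 := z, j := unit_vec (k j + 1) l)) = 0" if "(j, l) \<in> T" for j l
  proof -
    have "form (x(j := unit_vec (k j + 1) l, 0 := z)) = (\<Sum>r\<le>k 0. z $ r * L (j, l) r)"
      using expand[of 0 z "x(j := unit_vec (k j + 1) l)"] z by (simp add: L_def)
    also have "\<dots> = 0"
      using Lz[OF that] by (simp add: mult.commute lessThan_Suc_atMost)
    finally show ?thesis
      using that by (simp add: T_def fun_upd_twist)
  qed
  have main: "form (x(0 := z, j := y)) = 0" if "j \<in> {1..p}" "y \<in> carrier_vec (k j + 1)" for j y
  proof -
    have pivot: "form (x(0 := z, j := v)) = v $ q j * form (x(0 := z, j := unit_vec (k j + 1) (q j)))"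
      if v: "v \<in> carrier_vec (k j + 1)" for v
    proof -
      have "form (x(0 := z, j := v)) = (\<Sum>l\<le>k j. v $ l * form (x(0 := z, j := unit_vec (k j + 1) l)))"
        using \<open>j \<in> {1..p}\<close> v by (intro expand) auto
      also have "\<dots> = (\<Sum>l\<in>{q j}. v $ l * form (x(0 := z, j := unit_vec (k j + 1) l)))"
        using q \<open>j \<in> {1..p}\<close> off by (intro sum.mono_neutral_right) (auto simp: T_def)
      finally show ?thesis
        by simp
    qed
    have "x(0 := z, j := x j) = x(0 := z)"
      using that by (auto simp: fun_eq_iff)
    then have "form (x(0 := z, j := x j)) = 0"
      using form0[OF z(1)] by simp
    then have "form (x(0 := z, j := unit_vec (k j + 1) (q j))) = 0"
      using pivot[of "x j"] q x that(1) by auto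
    then show ?thesis
      using pivot[OF that(2)] by simp
  qed
  have "tangent_at p k A (x(0 := z))"
    unfolding tangent_at_def
  proof (intro allI ballI impI)
    fix j and y :: "complex vec" assume "j \<le> p" "y \<in> carrier_vec (k j + 1)"
    then have "form (x(0 := z, j := y)) = 0"
      using form0 main by (cases "j = 0") auto
    then show "tensor_pairing p k A (pure_tensor p k (x(0 := z, j := y))) = 0"
      by (simp add: form_def)
  qed
  with z show ?thesis
    using that by blast
qed

lemma tensor_pairing_tensor_act:
  assumes E: "\<And>j. j \<le> p \<Longrightarrow> E j \<in> carrier_mat (k j + 1) (k j + 1)"
    and x: "\<And>j. j \<le> p \<Longrightarrow> x j \<in> carrier_vec (k j + 1)"
  shows "tensor_pairing p k (tensor_act p k E a) (pure_tensor p k x) =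
    tensor_pairing p k a (pure_tensor p k (\<lambda>j. (E j)\<^sup>T *\<^sub>v x j))"
proof -
  have "tensor_pairing p k (tensor_act p k E a) (pure_tensor p k x) =
    (\<Sum>i\<in>multi_indices p k. \<Sum>l\<in>multi_indices p k. a l * (\<Prod>j\<le>p. E j $$ (i j, l j) * x j $ i j))"
    unfolding tensor_pairing_pure
    by (intro sum.cong refl) (auto simp: tensor_act_def sum_distrib_right sum_distrib_left prod.distrib ac_simps)
  also have "\<dots> = (\<Sum>l\<in>multi_indices p k. a l * (\<Sum>i\<in>multi_indices p k. \<Prod>j\<le>p. E j $$ (i j, l j) * x j $ i j))"
    by (subst sum.swap) (simp add: sum_distrib_left)
  also have "\<dots> = (\<Sum>l\<in>multi_indices p k. a l * (\<Prod>j\<le>p. ((E j)\<^sup>T *\<^sub>v x j) $ l j))"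
  proof (intro sum.cong refl arg_cong2[of _ _ _ _ "(*)"])
    fix l assume l: "l \<in> multi_indices p k"
    have "((E j)\<^sup>T *\<^sub>v x j) $ l j = (\<Sum>i\<le>k j. E j $$ (i, l j) * x j $ i)" if "j \<le> p" for j
      using E[OF that] x[OF that] multi_indices_le[OF l that]
      by (auto simp: scalar_prod_def lessThan_Suc_atMost[symmetric] lessThan_atLeast0 intro!: sum.cong)
    then show "(\<Sum>i\<in>multi_indices p k. \<Prod>j\<le>p. E j $$ (i j, l j) * x j $ i j) =
        (\<Prod>j\<le>p. ((E j)\<^sup>T *\<^sub>v x j) $ l j)"
      using sum_multi_indices_prod[of "\<lambda>j i. E j $$ (i, l j) * x j $ i" p k] by simp
  qed
  finally show ?thesis
    by (simp add: tensor_pairing_pure)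
qed

text \<open>
  The pairing with a tensor moved by \<open>E\<close> is the pairing with the original tensor after the
  transposed matrices have been applied to the vectors, so the tangent point moves by the transposed
  inverses.
\<close>

lemma tangent_at_tensor_act:
  assumes E: "\<And>j. j \<le> p \<Longrightarrow> E j \<in> carrier_mat (k j + 1) (k j + 1)"
    and F: "\<And>j. j \<le> p \<Longrightarrow> F j \<in> carrier_mat (k j + 1) (k j + 1)"
    and FE: "\<And>j. j \<le> p \<Longrightarrow> F j * E j = 1\<^sub>m (k j + 1)"
    and x: "\<And>j. j \<le> p \<Longrightarrow> x j \<in> carrier_vec (k j + 1) \<and> x j \<noteq> 0\<^sub>v (k j + 1)"
    and tan: "tangent_at p k a x"
  shows "\<exists>x. (\<forall>j\<le>p. x j \<in> carrier_vec (k j + 1) \<and> x j \<noteq> 0\<^sub>v (k j + 1)) \<and>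
    tangent_at p k (tensor_act p k E a) x"
proof -
  define z where "z = (\<lambda>j. (F j)\<^sup>T *\<^sub>v x j)"
  have Ez: "(E j)\<^sup>T *\<^sub>v z j = x j" if "j \<le> p" for j
  proof -
    have "(E j)\<^sup>T * (F j)\<^sup>T = (F j * E j)\<^sup>T"
      using E[OF that] F[OF that] transpose_mult[of "F j" _ _ "E j"] by simp
    then have "(E j)\<^sup>T * (F j)\<^sup>T = 1\<^sub>m (k j + 1)"
      using FE[OF that] by simp
    moreover have "(E j)\<^sup>T *\<^sub>v z j = ((E j)\<^sup>T * (F j)\<^sup>T) *\<^sub>v x j"
      unfolding z_def using E[OF that] F[OF that] x[OF that] by (subst assoc_mult_mat_vec) auto
    ultimately show ?thesis
      using x[OF that] by simp
  qed
  have zc: "z j \<in> carrier_vec (k j + 1)" if "j \<le> p" for j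
    using F[OF that] x[OF that] by (auto simp: z_def)
  have "z j \<noteq> 0\<^sub>v (k j + 1)" if "j \<le> p" for j
  proof
    assume "z j = 0\<^sub>v (k j + 1)"
    then have "(E j)\<^sup>T *\<^sub>v z j = 0\<^sub>v (k j + 1)"
      using E[OF that] by (auto intro!: eq_vecI)
    then show False
      using Ez[OF that] x[OF that] by simp
  qed
  moreover have "tangent_at p k (tensor_act p k E a) z"
    unfolding tangent_at_def
  proof (intro allI ballI impI)
    fix j and y :: "complex vec" assume j: "j \<le> p" and y: "y \<in> carrier_vec (k j + 1)"
    have "tensor_pairing p k (tensor_act p k E a) (pure_tensor p k (z(j := y))) =
       tensor_pairing p k a (pure_tensor p k (\<lambda>j'. (E j')\<^sup>T *\<^sub>v (z(j := y)) j'))"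
      using E zc y by (intro tensor_pairing_tensor_act) auto
    also have "\<dots> = tensor_pairing p k a (pure_tensor p k (x(j := (E j)\<^sup>T *\<^sub>v y)))"
      unfolding tensor_pairing_pure by (intro sum.cong refl arg_cong2[of _ _ _ _ "(*)"] prod.cong) (auto simp: Ez)
    also have "\<dots> = 0"
      using tan j E[OF j] y by (auto simp: tangent_at_def)
    finally show "tensor_pairing p k (tensor_act p k E a) (pure_tensor p k (z(j := y))) = 0" .
  qed
  ultimately show ?thesis
    using zc by blast
qed

section \<open>Blocks of zeros\<close>

definition eval_curve :: "'v cpoly \<Rightarrow> ('v \<Rightarrow> complex poly) \<Rightarrow> complex poly" where
  "eval_curve P a = (\<Sum>m\<in>Poly_Mapping.keys P.
     Polynomial.smult (Poly_Mapping.lookup P m) (\<Prod>v\<in>Poly_Mapping.keys m. a v ^ Poly_Mapping.lookup m v))"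

lemma poly_eval_curve: "poly (eval_curve P a) t = cpoly_eval P (\<lambda>v. poly (a v) t)"
  by (simp add: eval_curve_def cpoly_eval_def poly_sum poly_prod)

lemma dvd_diff_prod:
  fixes d :: "'a :: comm_ring_1"
  assumes "\<And>i. i \<in> I \<Longrightarrow> d dvd f i - g i"
  shows "d dvd prod f I - prod g I"
  using assms
proof (induction I rule: infinite_finite_induct)
  case (insert i I)
  have "prod f (insert i I) - prod g (insert i I) = (f i - g i) * prod f I + g i * (prod f I - prod g I)"
    using insert.hyps by (simp add: algebra_simps)
  then show ?case
    using insert by (metis dvd_add dvd_mult dvd_mult2 insertCI)
qed auto

lemma dvd_diff_power:
  fixes d :: "'a :: comm_ring_1"
  assumes "d dvd x - y"
  shows "d dvd x ^ n - y ^ n"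
  using dvd_diff_prod[of "{..<n}" d "\<lambda>_. x" "\<lambda>_. y"] assms by simp

lemma dvd_diff_sum:
  fixes d :: "'a :: comm_ring_1"
  assumes "\<And>i. i \<in> I \<Longrightarrow> d dvd f i - g i"
  shows "d dvd sum f I - sum g I"
  unfolding sum_subtractf[symmetric] using assms by (rule dvd_sum)

lemma dvd_diff_eval_curve:
  assumes "cpoly_vars P \<subseteq> I" "\<And>v. v \<in> I \<Longrightarrow> d dvd a v - b v"
  shows "d dvd eval_curve P a - eval_curve P b"
  unfolding eval_curve_def
proof (rule dvd_diff_sum)
  fix m assume "m \<in> Poly_Mapping.keys P"
  then have "d dvd (\<Prod>v\<in>Poly_Mapping.keys m. a v ^ Poly_Mapping.lookup m v) - (\<Prod>v\<in>Poly_Mapping.keys m. b v ^ Poly_Mapping.lookup m v)"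
    using assms by (intro dvd_diff_prod dvd_diff_power) (auto simp: cpoly_vars_def)
  then show "d dvd Polynomial.smult (Poly_Mapping.lookup P m) (\<Prod>v\<in>Poly_Mapping.keys m. a v ^ Poly_Mapping.lookup m v) -
    Polynomial.smult (Poly_Mapping.lookup P m) (\<Prod>v\<in>Poly_Mapping.keys m. b v ^ Poly_Mapping.lookup m v)"
    unfolding Polynomial.smult_diff_right[symmetric] by (rule Polynomial.dvd_smult)
qed

text \<open>
  The pullback of \<open>P\<close> to the curve is divisible by every power of the parameter, since modulo this
  power the curve can be replaced by one that runs inside \<open>S\<close>. Only the zero polynomial has this
  property.
\<close>

lemma zariski_closure_of_formal_curve:
  assumes supp: "\<And>v. v \<notin> I \<Longrightarrow> a v = 0"
    and approx: "\<And>N. \<exists>b. (\<forall>v\<in>I. [:0, 1:] ^ N dvd a v - b v) \<and> (\<forall>t. (\<lambda>v. poly (b v) t) \<in> S)"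
  shows "(\<lambda>v. poly (a v) t) \<in> zariski_closure I S"
proof -
  have "cpoly_eval P (\<lambda>v. poly (a v) t) = 0"
    if P: "cpoly_vars P \<subseteq> I" and S: "\<forall>b\<in>S. cpoly_eval P b = 0" for P
  proof -
    have dvd: "[:0, 1:] ^ N dvd eval_curve P a" for N
    proof -
      obtain b where b: "\<forall>v\<in>I. [:0, 1:] ^ N dvd a v - b v" "\<forall>t. (\<lambda>v. poly (b v) t) \<in> S"
        using approx by blast
      have "poly (eval_curve P b) t = 0" for t
        using S b(2) by (simp add: poly_eval_curve)
      then have "eval_curve P b = 0"
        using poly_all_0_iff_0 by blast
      then show ?thesis
        using dvd_diff_eval_curve[OF P, of "[:0, 1:] ^ N" a b] b(1) by simp
    qed
    have "eval_curve P a = 0"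
    proof (rule ccontr)
      assume "eval_curve P a \<noteq> 0"
      then have "Suc (degree (eval_curve P a)) \<le> degree (eval_curve P a)"
        using dvd_imp_degree_le[OF dvd[of "Suc (degree (eval_curve P a))"]]
        by (simp only: degree_linear_power not_False_eq_True)
      then show False
        by simp
    qed
    then show ?thesis
      by (simp add: poly_eval_curve[symmetric])
  qed
  then show ?thesis
    using supp by (auto simp: zariski_closure_def)
qed

text \<open>
  The restriction to \<open>{..p}\<close> makes the result extensional, as multi-indices are.
\<close>

definition slot_index :: "nat \<Rightarrow> nat \<Rightarrow> (nat \<Rightarrow> nat) \<Rightarrow> nat \<Rightarrow> nat" where
  "slot_index p r s = (\<lambda>j\<in>{..p}. if j = 0 then r else s j)"

lemma slot_index_simps [simp]:
  "slot_index p r s 0 = r" "j \<in> {1..p} \<Longrightarrow> slot_index p r s j = s j"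
  by (auto simp: slot_index_def)

lemma slot_index_in_multi_indices:
  assumes "r \<le> k 0" "\<And>j. j \<in> {1..p} \<Longrightarrow> s j \<le> k j"
  shows "slot_index p r s \<in> multi_indices p k"
  using assms by (auto simp: slot_index_def multi_indices_def)

lemma contraction_single:
  assumes "i \<in> multi_indices p k" "i 0 = r"
    and "\<And>i'. i' \<in> multi_indices p k \<Longrightarrow> i' 0 = r \<Longrightarrow> i' \<noteq> i \<Longrightarrow> c i' = 0"
  shows "contraction p k c X r = c i * (\<Prod>j=1..p. X j (i j))"
proof -
  have "contraction p k c X r = (\<Sum>i'\<in>{i}. c i' * (\<Prod>j=1..p. X j (i' j)))"
    unfolding contraction_def using assms by (intro sum.mono_neutral_right) auto
  then show ?thesis
    by simp
qed

lemma contraction_add: "contraction p k (\<lambda>i. c i + d i) X r = contraction p k c X r + contraction p k d X r"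
  by (simp add: contraction_def sum.distrib algebra_simps)

lemma contraction_mult: "contraction p k (\<lambda>i. e * c i) X r = e * contraction p k c X r"
  by (simp add: contraction_def sum_distrib_left algebra_simps)

lemma contraction_diff: "contraction p k (\<lambda>i. c i - d i) X r = contraction p k c X r - contraction p k d X r"
  by (simp add: contraction_def sum_subtractf algebra_simps)

lemma poly_contraction:
  "poly (contraction p k c X r) t = contraction p k (\<lambda>i. poly (c i) t) (\<lambda>j l. poly (X j l) t) r"
  by (simp add: contraction_def poly_sum poly_prod)

lemma dvd_diff_contraction:
  assumes "\<And>j l. d dvd X j l - Y j l"
  shows "d dvd contraction p k c X r - contraction p k c Y r"
  unfolding contraction_def
proof (rule dvd_diff_sum)
  fix i
  have "d dvd c i * ((\<Prod>j=1..p. X j (i j)) - (\<Prod>j=1..p. Y j (i j)))"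
    using assms by (intro dvd_mult dvd_diff_prod)
  then show "d dvd c i * (\<Prod>j=1..p. X j (i j)) - c i * (\<Prod>j=1..p. Y j (i j))"
    by (simp add: right_diff_distrib)
qed

text \<open>
  The tensor \<open>a\<close> gives \<open>k 0 + 1\<close> multilinear forms. On the product of the coordinate subspaces
  belonging to the sets \<open>B j\<close>, whose projectivizations have total dimension \<open>card I\<close>, only the forms
  with index in \<open>I\<close> are nonzero, and a common zero is expected. Approximate zeros are found
  along a curve of tensors that ends at \<open>a\<close>, in the affine chart in which the entry at a chosen
  \<open>q j \<in> B j\<close> equals 1. The remaining entries are indexed by \<open>T\<close>, and a bijection \<open>\<tau>\<close> assigns one of them to each form. For the tensor \<open>a0\<close> whose form of index
  \<open>r\<close> is the chart coordinate of index \<open>\<tau> r\<close>, the forms vanish at the origin of the chart. On the curve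
  \<open>a0 + \<epsilon> (a - a0)\<close> the equations read \<open>y = - \<epsilon> b(y)\<close>, where \<open>b\<close> denotes the forms of \<open>a - a0\<close>; iterating
  the right side solves them modulo every power of \<open>\<epsilon>\<close>. The residual is absorbed into the coefficient of
  the monomial that is equal to 1 at all points of the chart.
\<close>

lemma zero_block_in_segre_dual_variety:
  fixes a :: tensor
  assumes k0: "k 0 = (\<Sum>i=1..p. k i)"
    and E: "\<And>j. j \<le> p \<Longrightarrow> E j \<in> carrier_mat (k j + 1) (k j + 1)"
    and F: "\<And>j. j \<le> p \<Longrightarrow> F j \<in> carrier_mat (k j + 1) (k j + 1)"
    and FE: "\<And>j. j \<le> p \<Longrightarrow> F j * E j = 1\<^sub>m (k j + 1)"
    and B: "\<And>j. j \<in> {1..p} \<Longrightarrow> B j \<subseteq> {..k j} \<and> B j \<noteq> {}"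
    and I: "I \<subseteq> {..k 0}" and card: "card I = (\<Sum>j=1..p. card (B j) - 1)"
    and zero: "\<And>i. i \<in> multi_indices p k \<Longrightarrow> i 0 \<notin> I \<Longrightarrow> \<forall>j\<in>{1..p}. i j \<in> B j \<Longrightarrow> a i = 0"
  shows "tensor_act p k E a \<in> segre_dual_variety p k"
proof -
  define q where "q = (\<lambda>j. SOME l. l \<in> B j)"
  have q: "q j \<in> B j" if "j \<in> {1..p}" for j
    using B[OF that] by (simp add: q_def some_in_eq)
  have qk: "q j \<le> k j" if "j \<in> {1..p}" for j
    using q[OF that] B[OF that] by auto
  have finB: "finite (B j)" if "j \<in> {1..p}" for j
    using B[OF that] finite_subset by blast
  define T where "T = (SIGMA j:{1..p}. B j - {q j})"
  have "card T = (\<Sum>j=1..p. card (B j) - 1)"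
    unfolding T_def using finB q by (subst card_SigmaI) (auto intro!: sum.cong)
  moreover have "finite T" "finite I"
    using finB finite_subset[OF I] by (auto simp: T_def)
  ultimately obtain \<tau> where \<tau>: "bij_betw \<tau> I T"
    using card by (metis bij_betw_iff_card)
  define \<sigma> where "\<sigma> = the_inv_into I \<tau>"
  have \<sigma>\<tau>: "\<sigma> (\<tau> r) = r" if "r \<in> I" for r
    using \<tau> that by (auto simp: \<sigma>_def bij_betw_def the_inv_into_f_f)
  \<comment> \<open>\<open>X y j\<close> is the vector in slot \<open>j\<close> of the point of the chart with coordinates \<open>y\<close>.\<close>
  define X :: "(nat \<Rightarrow> complex poly) \<Rightarrow> nat \<Rightarrow> nat \<Rightarrow> complex poly"
    where "X = (\<lambda>y j l. if l = q j then 1 else if (j, l) \<in> T then y (\<sigma> (j, l)) else 0)"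
  define pt where "pt = (\<lambda>r. q(fst (\<tau> r) := snd (\<tau> r)))"
  define a0 :: tensor where "a0 = (\<lambda>i. if i 0 \<in> I \<and> i = slot_index p (i 0) (pt (i 0)) then 1 else 0)"
  define b where "b = (\<lambda>i. a i - a0 i)"
  \<comment> \<open>The line from \<open>a0\<close> at parameter 0 to \<open>a\<close> at parameter 1.\<close>
  define c where "c = (\<lambda>i. [:a0 i, b i:])"
  have X_dvd: "d dvd X y j l - X y' j l" if "\<And>r. d dvd y r - y' r" for d y y' j l
    using that by (simp add: X_def)
  have prodq: "(\<Prod>j=1..p. X y j (slot_index p r q j)) = 1" for y r
    by (intro prod.neutral) (auto simp: X_def)
  have contr_a0: "contraction p k (\<lambda>i. [:a0 i:]) (X y) r = y r" if r: "r \<in> I" for y r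
  proof -
    obtain j0 l0 where jl: "\<tau> r = (j0, l0)"
      by fastforce
    then have T: "(j0, l0) \<in> T"
      using \<tau> r by (metis bij_betwE)
    then have j0: "j0 \<in> {1..p}" "l0 \<in> B j0" "l0 \<noteq> q j0"
      by (auto simp: T_def)
    have "slot_index p r (pt r) \<in> multi_indices p k"
      using r I qk j0 B[OF j0(1)] by (intro slot_index_in_multi_indices) (auto simp: pt_def jl)
    then have "contraction p k (\<lambda>i. [:a0 i:]) (X y) r =
        [:a0 (slot_index p r (pt r)):] * (\<Prod>j=1..p. X y j (slot_index p r (pt r) j))"
      by (rule contraction_single) (auto simp: a0_def)
    also have "(\<Prod>j=1..p. X y j (slot_index p r (pt r) j)) = (\<Prod>j=1..p. if j = j0 then y r else 1)"
      using T j0 \<sigma>\<tau>[OF r] by (intro prod.cong) (auto simp: X_def pt_def jl)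
    also have "\<dots> = y r"
      using j0 by simp
    also have "a0 (slot_index p r (pt r)) = 1"
      using r by (simp add: a0_def)
    finally show ?thesis
      by simp
  qed
  have a0_zero: "a0 i = 0" if "i 0 \<notin> I" for i
    using that by (simp add: a0_def)
  have contr_off: "contraction p k d (X y) r = 0"
    if r: "r \<notin> I" and d: "\<And>i. i \<in> multi_indices p k \<Longrightarrow> i 0 \<notin> I \<Longrightarrow> \<forall>j\<in>{1..p}. i j \<in> B j \<Longrightarrow> d i = 0" for d y r
    unfolding contraction_def
  proof (intro sum.neutral ballI)
    fix i assume i: "i \<in> {i \<in> multi_indices p k. i 0 = r}"
    show "d i * (\<Prod>j=1..p. X y j (i j)) = 0"
    proof (cases "\<forall>j\<in>{1..p}. i j \<in> B j")
      case True
      then show ?thesis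
        using i r d by simp
    next
      case False
      then obtain j where "j \<in> {1..p}" "i j \<notin> B j"
        by blast
      then have "X y j (i j) = 0"
        using q[of j] by (auto simp: X_def T_def)
      then have "(\<Prod>j=1..p. X y j (i j)) = 0"
        using \<open>j \<in> {1..p}\<close> by (intro prod_zero) auto
      then show ?thesis
        by simp
    qed
  qed
  define y where "y = rec_nat (\<lambda>_. 0) (\<lambda>_ u r. - ([:0, 1:] * contraction p k (\<lambda>i. [:b i:]) (X u) r))"
  have y_Suc: "y (Suc N) r = - ([:0, 1:] * contraction p k (\<lambda>i. [:b i:]) (X (y N)) r)" for N r
    by (simp add: y_def)
  have y_dvd: "[:0, 1:] ^ N dvd y N r - y (Suc N) r" for N r
  proof (induction N arbitrary: r)
    case (Suc N)
    have "[:0, 1:] ^ N dvd contraction p k (\<lambda>i. [:b i:]) (X (y (Suc N))) r - contraction p k (\<lambda>i. [:b i:]) (X (y N)) r"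
      using Suc.IH by (intro dvd_diff_contraction X_dvd) (metis dvd_minus_iff minus_diff_eq)
    then have "[:0, 1:] ^ Suc N dvd [:0, 1:] *
        (contraction p k (\<lambda>i. [:b i:]) (X (y (Suc N))) r - contraction p k (\<lambda>i. [:b i:]) (X (y N)) r)"
      by (simp only: power_Suc) (rule mult_dvd_mono, rule dvd_refl)
    also have "\<dots> = y (Suc N) r - y (Suc (Suc N)) r"
      by (simp only: y_Suc right_diff_distrib) simp
    finally show ?case .
  qed auto
  \<comment> \<open>For \<open>r\<close> in \<open>I\<close> the residual is the difference of two consecutive iterates; for the other \<open>r\<close> it is zero.\<close>
  define R where "R = (\<lambda>N r. contraction p k c (X (y N)) r)"
  have R: "R N r = (if r \<in> I then y N r - y (Suc N) r else 0)" for N r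
  proof (cases "r \<in> I")
    case True
    have "c = (\<lambda>i. [:a0 i:] + [:0, 1:] * [:b i:])"
      by (simp add: c_def fun_eq_iff)
    then have "R N r = y N r + [:0, 1:] * contraction p k (\<lambda>i. [:b i:]) (X (y N)) r"
      using contr_a0[OF True] by (simp only: R_def contraction_add contraction_mult)
    then show ?thesis
      using True by (simp only: y_Suc if_True) simp
  next
    case False
    have "c i = 0" if "i \<in> multi_indices p k" "i 0 \<notin> I" "\<forall>j\<in>{1..p}. i j \<in> B j" for i
      using zero[OF that] a0_zero[of i] that(2) by (simp add: c_def b_def)
    then show ?thesis
      using False contr_off[OF False, of c] by (simp add: R_def)
  qed
  have R_dvd: "[:0, 1:] ^ N dvd R N r" for N r
    using y_dvd by (simp add: R)
  \<comment> \<open>At the index \<open>q\<close> all factors of the monomial are 1, so changing this entry shifts the form by a constant.\<close>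
  define c' where "c' = (\<lambda>N i. c i - (if i = slot_index p (i 0) q then R N (i 0) else 0))"
  have contr_c': "contraction p k (c' N) (X (y N)) r = 0" if "r \<le> k 0" for N r
  proof -
    have "contraction p k (\<lambda>i. if i = slot_index p (i 0) q then R N (i 0) else 0) (X (y N)) r =
        (if slot_index p r q = slot_index p r q then R N r else 0) * (\<Prod>j=1..p. X (y N) j (slot_index p r q j))"
      using slot_index_in_multi_indices[of r k p q] that qk by (subst contraction_single[of "slot_index p r q"]) auto
    also have "\<dots> = R N r"
      unfolding prodq by simp
    finally show ?thesis
      unfolding c'_def contraction_diff R_def by simp
  qed
  let ?S = "{A \<in> tensors p k. \<exists>x. (\<forall>j\<le>p. x j \<in> carrier_vec (k j + 1) \<and> x j \<noteq> 0\<^sub>v (k j + 1)) \<and> tangent_at p k A x}"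
  have deg: "tensor_act p k E (\<lambda>i. poly (c' N i) t) \<in> ?S" for N t
  proof -
    define x where "x = (\<lambda>j. vec (k j + 1) (\<lambda>l. poly (X (y N) j l) t))"
    have xnz: "x j \<in> carrier_vec (k j + 1) \<and> x j \<noteq> 0\<^sub>v (k j + 1)" if "j \<in> {1..p}" for j
    proof -
      have "x j $ q j = 1"
        using qk[OF that] by (simp add: x_def X_def)
      then have "x j \<noteq> 0\<^sub>v (k j + 1)"
        using qk[OF that] by auto
      then show ?thesis
        by (simp add: x_def)
    qed
    have "contraction p k (\<lambda>i. poly (c' N i) t) (\<lambda>j l. x j $ l) r = 0" if "r \<le> k 0" for r
    proof -
      have "contraction p k (\<lambda>i. poly (c' N i) t) (\<lambda>j l. x j $ l) r =
          contraction p k (\<lambda>i. poly (c' N i) t) (\<lambda>j l. poly (X (y N) j l) t) r"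
        unfolding contraction_def
        by (intro sum.cong refl arg_cong2[of _ _ _ _ "(*)"] prod.cong) (auto simp: x_def multi_indices_le less_Suc_eq_le)
      also have "\<dots> = 0"
        using contr_c'[OF that, of N] by (metis poly_0 poly_contraction)
      finally show ?thesis .
    qed
    then obtain z where z: "z \<in> carrier_vec (k 0 + 1)" "z \<noteq> 0\<^sub>v (k 0 + 1)"
      and tan: "tangent_at p k (\<lambda>i. poly (c' N i) t) (x(0 := z))"
      using contraction_zero_imp_tangent[where k = k and p = p and x = x, OF k0 xnz] by blast
    have "(x(0 := z)) j \<in> carrier_vec (k j + 1) \<and> (x(0 := z)) j \<noteq> 0\<^sub>v (k j + 1)" if "j \<le> p" for j
      using xnz[of j] z that by (cases "j = 0") auto
    then show ?thesis
      using tangent_at_tensor_act[OF E F FE _ tan] by auto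
  qed
  \<comment> \<open>Since the action of \<open>E\<close> is linear, it carries both curves to polynomial curves in standard coordinates.\<close>
  define M :: "(nat \<Rightarrow> nat) \<Rightarrow> (nat \<Rightarrow> nat) \<Rightarrow> complex" where "M = (\<lambda>i l. \<Prod>j\<le>p. E j $$ (i j, l j))"
  define lift where "lift = (\<lambda>d i. if i \<in> multi_indices p k then \<Sum>l\<in>multi_indices p k. Polynomial.smult (M i l) (d l) else 0)"
  have poly_lift: "(\<lambda>i. poly (lift d i) t) = tensor_act p k E (\<lambda>i. poly (d i) t)" for d t
    by (auto simp: lift_def tensor_act_def fun_eq_iff poly_sum M_def)
  have "(\<lambda>i. poly (lift c i) 1) \<in> zariski_closure (multi_indices p k) ?S"
  proof (rule zariski_closure_of_formal_curve)
    fix N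
    have "[:0, 1:] ^ N dvd lift c i - lift (c' N) i" if "i \<in> multi_indices p k" for i
    proof -
      have "[:0, 1:] ^ N dvd Polynomial.smult (M i l) (c l) - Polynomial.smult (M i l) (c' N l)" for l
        unfolding Polynomial.smult_diff_right[symmetric] c'_def by (rule Polynomial.dvd_smult) (use R_dvd in auto)
      then show ?thesis
        using that by (simp add: lift_def dvd_diff_sum)
    qed
    then show "\<exists>b. (\<forall>v\<in>multi_indices p k. [:0, 1:] ^ N dvd lift c v - b v) \<and> (\<forall>t. (\<lambda>v. poly (b v) t) \<in> ?S)"
      using deg unfolding poly_lift[symmetric] by blast
  qed (simp add: lift_def)
  moreover have "(\<lambda>i. poly (c i) 1) = a"
    by (simp add: c_def b_def)
  ultimately show ?thesis
    unfolding poly_lift segre_dual_variety_def by simp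
qed

section \<open>Weight bases\<close>

lemma poly_eq_if_eq_off_zero:
  fixes P Q :: "complex poly"
  assumes "\<And>s. s \<noteq> 0 \<Longrightarrow> poly P s = poly Q s"
  shows "P = Q"
proof -
  have "poly ([:0, 1:] * (P - Q)) s = 0" for s
    using assms[of s] by (cases "s = 0") auto
  then have "[:0, 1:] * (P - Q) = 0"
    using poly_all_0_iff_0 by blast
  then show ?thesis
    by simp
qed

text \<open>
  Read \<open>Q w v\<close> as: the vector \<open>v\<close> has weight \<open>w\<close>. A minimal generating subset of \<open>V\<close> is a
  basis; sorting it by the weights gives the numbering. With \<open>\<sigma> = 1\<close> the weights increase, with
  \<open>\<sigma> = - 1\<close> they decrease.
\<close>

lemma weight_vectors_basis:
  fixes V :: "complex vec set"
  assumes V: "finite V" "V \<subseteq> carrier_vec n"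
    and units: "\<And>c. c < n \<Longrightarrow> \<exists>vs. set vs \<subseteq> V \<and> (\<forall>r<n. (\<Sum>v\<leftarrow>vs. v $ r) = (if r = c then 1 else 0))"
    and wt: "\<And>v. v \<in> V \<Longrightarrow> \<exists>w. Q w v"
  obtains e and w :: "nat \<Rightarrow> int" where "is_basis n e" "\<And>i. i < n \<Longrightarrow> Q (w i) (e i)"
    "\<And>i j. i \<le> j \<Longrightarrow> j < n \<Longrightarrow> \<sigma> * w i \<le> \<sigma> * w j"
proof -
  interpret vec_space "TYPE(complex)" n .
  have units_span: "set (unit_vecs n) \<subseteq> span V"
  proof
    fix u :: "complex vec" assume "u \<in> set (unit_vecs n)"
    then obtain c where c: "c < n" "u = unit_vec n c"
      by (auto simp: unit_vecs_def)
    obtain vs where vs: "set vs \<subseteq> V" "\<And>r. r < n \<Longrightarrow> (\<Sum>v\<leftarrow>vs. v $ r) = (if r = c then 1 else 0)"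
      using units[OF c(1)] by blast
    have vsc: "x \<in> carrier_vec n" if "x \<in> set vs" for x
      using vs(1) V(2) that by auto
    have "u = sumlist vs"
      using c vs(2) sumlist_dim[OF vsc] by (intro eq_vecI) (auto simp: sumlist_vec_index[OF vsc])
    also have "\<dots> \<in> span V"
      using vs(1) in_own_span V(2) by (intro sumlist_in_span) auto
    finally show "u \<in> span V" .
  qed
  have "span (set (unit_vecs n)) \<subseteq> span V"
    by (rule span_subsetI[OF V(2) units_span])
  then have "carrier_vec n \<subseteq> span V"
    by (simp only: span_unit_vecs_is_carrier)
  moreover have "span V \<subseteq> carrier_vec n"
    by (rule span_is_subset2) (use V(2) in simp)
  ultimately have spanV: "span V = carrier_vec n"
    by (intro equalityI)
  have "gen_set V"
    unfolding spanV by simp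
  then obtain \<beta> where \<beta>: "\<beta> \<subseteq> V" "minimal \<beta> (\<lambda>S. S \<subseteq> carrier_vec n \<and> gen_set S)"
    using minimal_exists[OF V(1), of "\<lambda>S. S \<subseteq> carrier_vec n \<and> gen_set S"] V(2) by auto
  have basis: "basis \<beta>"
    using \<beta>(2) by (intro min_gen_is_basis) auto
  have fin: "finite \<beta>"
    using \<beta>(1) V(1) finite_subset by blast
  have card: "card \<beta> = n"
    using dim_basis[OF fin basis] dim_is_n by simp
  obtain wt where wt: "\<And>v. v \<in> \<beta> \<Longrightarrow> Q (wt v) v"
    using wt \<beta>(1) by (metis subsetD)
  obtain vs where vs: "set vs = \<beta>" "distinct vs"
    using finite_distinct_list[OF fin] by blast
  define L where "L = sort_key (\<lambda>v. \<sigma> * wt v) vs"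
  have L: "set L = \<beta>" "distinct L" "length L = n" "sorted (map (\<lambda>v. \<sigma> * wt v) L)"
    using vs card distinct_card[of L] by (auto simp: L_def)
  show ?thesis
  proof (rule that[of "\<lambda>i. L ! i" "\<lambda>i. wt (L ! i)"])
    have "(\<lambda>i. L ! i) ` {..<n} = \<beta>"
      using L by (auto simp: set_conv_nth)
    then show "is_basis n (\<lambda>i. L ! i)"
      using basis L by (auto simp: is_basis_def inj_on_def nth_eq_iff_index_eq)
    show "Q (wt (L ! i)) (L ! i)" if "i < n" for i
      using wt L that by (metis nth_mem)
    show "\<sigma> * wt (L ! i) \<le> \<sigma> * wt (L ! j)" if "i \<le> j" "j < n" for i j
      using sorted_nth_mono[OF L(4) that(1)] that L(3) by simp
  qed
qed

text \<open>
  Let \<open>\<rho> t = \<Sum>m. t\<^bsup>m - N\<^esup> M\<^sub>m\<close> with constant matrices \<open>M\<^sub>m\<close>. Comparing coefficients of \<open>s\<close> in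
  \<open>\<rho> t * \<rho> s = \<rho> (t * s)\<close> gives \<open>\<rho> t * M\<^sub>m = t\<^bsup>m - N\<^esup> M\<^sub>m\<close>, so the columns of \<open>M\<^sub>m\<close> are weight vectors. They
  span the space because the sum of all \<open>M\<^sub>m\<close> is \<open>\<rho> 1 = 1\<close>.
\<close>

lemma torus_representation_weight_basis:
  fixes \<rho> :: "complex \<Rightarrow> complex mat"
  assumes car: "\<And>t. t \<noteq> 0 \<Longrightarrow> \<rho> t \<in> carrier_mat n n"
    and hom: "\<And>s t. s \<noteq> 0 \<Longrightarrow> t \<noteq> 0 \<Longrightarrow> \<rho> (t * s) = \<rho> t * \<rho> s"
    and one: "\<rho> 1 = 1\<^sub>m n"
    and laurent: "\<And>r c. r < n \<Longrightarrow> c < n \<Longrightarrow>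
      \<exists>(q :: complex poly) (N :: nat). \<forall>t. t \<noteq> 0 \<longrightarrow> \<rho> t $$ (r, c) = poly q t / t ^ N"
  obtains e and w :: "nat \<Rightarrow> int" where "is_basis n e"
    "\<And>i t. i < n \<Longrightarrow> t \<noteq> 0 \<Longrightarrow> \<rho> t *\<^sub>v e i = (t powi w i) \<cdot>\<^sub>v e i"
    "\<And>i j. i \<le> j \<Longrightarrow> j < n \<Longrightarrow> \<sigma> * w i \<le> \<sigma> * w j"
proof -
  obtain q N where qN: "\<And>r c t. r < n \<Longrightarrow> c < n \<Longrightarrow> t \<noteq> 0 \<Longrightarrow> \<rho> t $$ (r, c) = poly (q r c) t / t ^ N r c"
    using laurent by metis
  \<comment> \<open>The power \<open>t ^ N0\<close> is a common denominator of all entries.\<close>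
  define N0 where "N0 = (\<Sum>r<n. \<Sum>c<n. N r c)"
  have N0: "N r c \<le> N0" if "r < n" "c < n" for r c
  proof -
    have "N r c \<le> (\<Sum>c<n. N r c)"
      using that by (intro member_le_sum) auto
    also have "\<dots> \<le> N0"
      unfolding N0_def using that by (intro member_le_sum) auto
    finally show ?thesis .
  qed
  define P where "P = (\<lambda>r c. q r c * [:0, 1:] ^ (N0 - N r c))"
  have P: "poly (P r c) t = \<rho> t $$ (r, c) * t ^ N0" if "r < n" "c < n" "t \<noteq> 0" for r c t
  proof -
    have "t ^ N0 = t ^ N r c * t ^ (N0 - N r c)"
      using N0[OF that(1,2)] by (simp add: power_add[symmetric])
    then show ?thesis
      using that by (simp add: P_def qN)
  qed
  define D where "D = (\<Sum>r<n. \<Sum>c<n. degree (P r c))"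
  have D: "degree (P r c) \<le> D" if "r < n" "c < n" for r c
  proof -
    have "degree (P r c) \<le> (\<Sum>c<n. degree (P r c))"
      using that by (intro member_le_sum) auto
    also have "\<dots> \<le> D"
      unfolding D_def using that by (intro member_le_sum) auto
    finally show ?thesis .
  qed
  \<comment> \<open>\<open>v m c\<close> is the column \<open>c\<close> of the coefficient matrix of \<open>t\<^bsup>m - N0\<^esup>\<close>.\<close>
  define v where "v = (\<lambda>m c. vec n (\<lambda>r. coeff (P r c) m))"
  have weight: "\<rho> t *\<^sub>v v m c = (t powi (int m - int N0)) \<cdot>\<^sub>v v m c" if t: "t \<noteq> 0" and c: "c < n" for t m c
  proof (rule eq_vecI)
    fix r assume "r < dim_vec (t powi (int m - int N0) \<cdot>\<^sub>v v m c)"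
    then have r: "r < n"
      by (simp add: v_def)
    have "(\<Sum>l<n. Polynomial.smult (\<rho> t $$ (r, l)) (P l c)) =
        Polynomial.smult (1 / t ^ N0) (pcompose (P r c) [:0, t:])"
    proof (rule poly_eq_if_eq_off_zero)
      fix s :: complex assume s: "s \<noteq> 0"
      have "poly (\<Sum>l<n. Polynomial.smult (\<rho> t $$ (r, l)) (P l c)) s = (\<Sum>l<n. \<rho> t $$ (r, l) * \<rho> s $$ (l, c)) * s ^ N0"
        using s c by (simp add: poly_sum P sum_distrib_right mult.assoc)
      also have "(\<Sum>l<n. \<rho> t $$ (r, l) * \<rho> s $$ (l, c)) = \<rho> (t * s) $$ (r, c)"
        using car[OF t] car[OF s] r c by (simp add: hom s t scalar_prod_def lessThan_atLeast0)
      also have "\<dots> * s ^ N0 = poly (Polynomial.smult (1 / t ^ N0) (pcompose (P r c) [:0, t:])) s"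
        using r c s t by (simp add: poly_pcompose P mult.commute[of s t] power_mult_distrib)
      finally show "poly (\<Sum>l<n. Polynomial.smult (\<rho> t $$ (r, l)) (P l c)) s =
          poly (Polynomial.smult (1 / t ^ N0) (pcompose (P r c) [:0, t:])) s" .
    qed
    then have "coeff (\<Sum>l<n. Polynomial.smult (\<rho> t $$ (r, l)) (P l c)) m =
        coeff (Polynomial.smult (1 / t ^ N0) (pcompose (P r c) [:0, t:])) m"
      by simp
    then have "(\<Sum>l<n. \<rho> t $$ (r, l) * coeff (P l c) m) = t ^ m / t ^ N0 * coeff (P r c) m"
      by (simp add: coeff_sum coeff_pcompose_linear)
    also have "t ^ m / t ^ N0 = t powi (int m - int N0)"
      using t by (simp add: power_int_diff)
    finally show "(\<rho> t *\<^sub>v v m c) $ r = (t powi (int m - int N0) \<cdot>\<^sub>v v m c) $ r"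
      using car[OF t] r by (simp add: v_def scalar_prod_def lessThan_atLeast0)
  qed (use car[OF t] in \<open>auto simp: v_def\<close>)
  define V where "V = (\<lambda>(m, c). v m c) ` ({..D} \<times> {..<n})"
  have V: "finite V" "V \<subseteq> carrier_vec n"
    by (auto simp: V_def v_def)
  have units: "\<exists>vs. set vs \<subseteq> V \<and> (\<forall>r<n. (\<Sum>v\<leftarrow>vs. v $ r) = (if r = c then 1 else 0))" if c: "c < n" for c
  proof (intro exI conjI allI impI)
    show "set (map (\<lambda>m. v m c) [0..<Suc D]) \<subseteq> V"
      using c by (auto simp: V_def)
    fix r assume r: "r < n"
    have "(\<Sum>u\<leftarrow>map (\<lambda>m. v m c) [0..<Suc D]. u $ r) = (\<Sum>m\<le>D. coeff (P r c) m)"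
      using r by (simp add: v_def comp_def interv_sum_list_conv_sum_set_nat atLeast0LessThan lessThan_Suc_atMost del: upt_Suc)
    also have "\<dots> = poly (P r c) 1"
      unfolding poly_altdef power_one mult_1_right using D[OF r c]
      by (intro sum.mono_neutral_right) (auto intro: coeff_eq_0)
    also have "\<dots> = (if r = c then 1 else 0)"
      using r c by (simp add: P one)
    finally show "(\<Sum>u\<leftarrow>map (\<lambda>m. v m c) [0..<Suc D]. u $ r) = (if r = c then 1 else 0)" .
  qed
  have weight_V: "\<exists>w. \<forall>t. t \<noteq> 0 \<longrightarrow> \<rho> t *\<^sub>v u = (t powi w) \<cdot>\<^sub>v u" if u: "u \<in> V" for u
  proof -
    obtain m c where "c < n" "u = v m c"
      using u by (auto simp: V_def)
    then show ?thesis
      using weight by blast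
  qed
  show ?thesis
  proof (rule weight_vectors_basis[of V n "\<lambda>w u. \<forall>t. t \<noteq> 0 \<longrightarrow> \<rho> t *\<^sub>v u = (t powi w) \<cdot>\<^sub>v u" \<sigma>])
    show "finite V" "V \<subseteq> carrier_vec n"
      by (rule V)+
    show "\<exists>vs. set vs \<subseteq> V \<and> (\<forall>r<n. (\<Sum>v\<leftarrow>vs. v $ r) = (if r = c then 1 else 0))" if "c < n" for c
      by (rule units[OF that])
    show "\<exists>w. \<forall>t. t \<noteq> 0 \<longrightarrow> \<rho> t *\<^sub>v u = (t powi w) \<cdot>\<^sub>v u" if "u \<in> V" for u
      by (rule weight_V[OF that])
  next
    fix e and w :: "nat \<Rightarrow> int"
    assume "is_basis n e"
      and "\<And>i. i < n \<Longrightarrow> \<forall>t. t \<noteq> 0 \<longrightarrow> \<rho> t *\<^sub>v e i = (t powi w i) \<cdot>\<^sub>v e i"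
      and "\<And>i j. i \<le> j \<Longrightarrow> j < n \<Longrightarrow> \<sigma> * w i \<le> \<sigma> * w j"
    then show thesis
      by (intro that) auto
  qed
qed

section \<open>Weights of nondegenerate tensors\<close>

lemma degenerate_in_segre_dual_variety:
  assumes "A \<in> tensors p k"
    and "\<forall>j\<le>p. x j \<in> carrier_vec (k j + 1) \<and> x j \<noteq> 0\<^sub>v (k j + 1)" "tangent_at p k A x"
  shows "A \<in> segre_dual_variety p k"
proof -
  have "A i = 0" if "i \<notin> multi_indices p k" for i
    using assms(1) that by (simp add: tensors_def)
  then show ?thesis
    using assms unfolding segre_dual_variety_def zariski_closure_def by blast
qed

lemma index_with_sum:
  fixes k :: "nat \<Rightarrow> nat"
  assumes "finite J" "m \<le> sum k J"
  shows "\<exists>\<beta>. (\<forall>j\<in>J. \<beta> j \<le> k j) \<and> sum \<beta> J = m"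
  using assms
proof (induction J arbitrary: m)
  case (insert j J)
  have "m - min m (k j) \<le> sum k J"
    using insert.prems insert.hyps(1,2) unfolding sum.insert[OF insert.hyps(1,2)] by arith
  then obtain \<beta> where \<beta>: "\<forall>j\<in>J. \<beta> j \<le> k j" "sum \<beta> J = m - min m (k j)"
    using insert.IH by blast
  have "sum (\<beta>(j := min m (k j))) J = sum \<beta> J"
    using insert.hyps by (intro sum.cong) auto
  then have "sum (\<beta>(j := min m (k j))) (insert j J) = m"
    using insert.hyps \<beta> by simp
  moreover have "\<forall>i\<in>insert j J. (\<beta>(j := min m (k j))) i \<le> k i"
    using \<beta> by auto
  ultimately show ?case
    by blast
qed auto

text \<open>
  For \<open>m = \<Sum>j. \<beta> j\<close>, too large a value of \<open>U m\<close> produces a block of zeros below \<open>\<beta>\<close>: there the sum of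
  the \<open>w j (i j)\<close> is at most that at \<open>\<beta>\<close>, hence smaller than \<open>U (i 0)\<close> for all \<open>i 0 \<ge> m\<close>. Too small a value
  produces a block of zeros above \<open>\<beta>\<close>. In both cases the size of the block is the critical one.
\<close>

lemma weights_additive:
  fixes a :: tensor and U :: "nat \<Rightarrow> int" and w :: "nat \<Rightarrow> nat \<Rightarrow> int"
  assumes k0: "k 0 = (\<Sum>i=1..p. k i)"
    and E: "\<And>j. j \<le> p \<Longrightarrow> E j \<in> carrier_mat (k j + 1) (k j + 1)"
    and F: "\<And>j. j \<le> p \<Longrightarrow> F j \<in> carrier_mat (k j + 1) (k j + 1)"
    and FE: "\<And>j. j \<le> p \<Longrightarrow> F j * E j = 1\<^sub>m (k j + 1)"
    and nondeg: "tensor_act p k E a \<notin> segre_dual_variety p k"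
    and monoU: "\<And>r s. r \<le> s \<Longrightarrow> s \<le> k 0 \<Longrightarrow> U r \<le> U s"
    and monow: "\<And>j r s. j \<in> {1..p} \<Longrightarrow> r \<le> s \<Longrightarrow> s \<le> k j \<Longrightarrow> w j r \<le> w j s"
    and supp: "\<And>i. i \<in> multi_indices p k \<Longrightarrow> a i \<noteq> 0 \<Longrightarrow> U (i 0) = (\<Sum>j=1..p. w j (i j))"
    and \<beta>: "\<And>j. j \<in> {1..p} \<Longrightarrow> \<beta> j \<le> k j"
  shows "U (\<Sum>j=1..p. \<beta> j) = (\<Sum>j=1..p. w j (\<beta> j))"
proof (rule antisym)
  have m: "(\<Sum>j=1..p. \<beta> j) \<le> k 0"
    unfolding k0 by (intro sum_mono \<beta>)
  show "U (\<Sum>j=1..p. \<beta> j) \<le> (\<Sum>j=1..p. w j (\<beta> j))"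
  proof (rule ccontr)
    assume gt: "\<not> ?thesis"
    have "tensor_act p k E a \<in> segre_dual_variety p k"
    proof (rule zero_block_in_segre_dual_variety[OF k0 E F FE, where B = "\<lambda>j. {..\<beta> j}" and I = "{..<\<Sum>j=1..p. \<beta> j}"])
      fix i assume i: "i \<in> multi_indices p k" "i 0 \<notin> {..<\<Sum>j=1..p. \<beta> j}" "\<forall>j\<in>{1..p}. i j \<in> {..\<beta> j}"
      show "a i = 0"
      proof (rule ccontr)
        assume "a i \<noteq> 0"
        then have "U (i 0) = (\<Sum>j=1..p. w j (i j))"
          using i by (intro supp)
        also have "\<dots> \<le> (\<Sum>j=1..p. w j (\<beta> j))"
          using i \<beta> by (intro sum_mono monow) auto
        also have "\<dots> < U (\<Sum>j=1..p. \<beta> j)"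
          using gt by simp
        also have "\<dots> \<le> U (i 0)"
          using i by (intro monoU) (auto simp: multi_indices_le)
        finally show False
          by simp
      qed
    qed (use \<beta> m in auto)
    then show False
      using nondeg by simp
  qed
  show "(\<Sum>j=1..p. w j (\<beta> j)) \<le> U (\<Sum>j=1..p. \<beta> j)"
  proof (rule ccontr)
    assume lt: "\<not> ?thesis"
    have "tensor_act p k E a \<in> segre_dual_variety p k"
    proof (rule zero_block_in_segre_dual_variety[OF k0 E F FE, where B = "\<lambda>j. {\<beta> j..k j}" and I = "{\<Sum>j=1..p. \<beta> j<..k 0}"])
      fix i assume i: "i \<in> multi_indices p k" "i 0 \<notin> {\<Sum>j=1..p. \<beta> j<..k 0}" "\<forall>j\<in>{1..p}. i j \<in> {\<beta> j..k j}"
      show "a i = 0"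
      proof (rule ccontr)
        assume "a i \<noteq> 0"
        have "U (i 0) \<le> U (\<Sum>j=1..p. \<beta> j)"
          using i m multi_indices_le[OF i(1), of 0] by (intro monoU) auto
        also have "\<dots> < (\<Sum>j=1..p. w j (\<beta> j))"
          using lt by simp
        also have "\<dots> \<le> (\<Sum>j=1..p. w j (i j))"
          using i by (intro sum_mono monow) auto
        also have "\<dots> = U (i 0)"
          using i \<open>a i \<noteq> 0\<close> by (intro supp[symmetric])
        finally show False
          by simp
      qed
    next
      have "(\<Sum>j=1..p. k j - \<beta> j) = (\<Sum>j=1..p. k j) - (\<Sum>j=1..p. \<beta> j)"
        by (intro sum_subtractf_nat \<beta>)
      then show "card {\<Sum>j=1..p. \<beta> j<..k 0} = (\<Sum>j=1..p. card {\<beta> j..k j} - 1)"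
        using k0 by simp
    qed (use \<beta> in auto)
    then show False
      using nondeg by simp
  qed
qed

lemma sum_two_slots:
  fixes g :: "nat \<Rightarrow> 'a :: comm_monoid_add"
  assumes "finite S" "j \<in> S" "l \<in> S" "j \<noteq> l"
  shows "sum g S = g j + g l + sum g (S - {j, l})"
proof -
  have "sum g S = g j + (g l + sum g (S - {j} - {l}))"
    using assms by (simp add: sum.remove[of S j] sum.remove[of "S - {j}" l])
  moreover have "S - {j} - {l} = S - {j, l}"
    by auto
  ultimately show ?thesis
    by (simp add: add.assoc)
qed

text \<open>
  Raising the entry of \<open>\<beta>\<close> in slot \<open>j\<close> by one changes \<open>U\<close> in the same way as raising the entry in
  another slot \<open>l\<close>, so every gap of \<open>w j\<close> equals every gap of \<open>w l\<close>. For two gaps in the same slot the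
  comparison passes through a second slot with \<open>k l \<ge> 1\<close>.
\<close>

lemma additive_weights_affine:
  fixes U :: "nat \<Rightarrow> int" and w :: "nat \<Rightarrow> nat \<Rightarrow> int"
  assumes add: "\<And>\<beta>. (\<And>j. j \<in> {1..p} \<Longrightarrow> \<beta> j \<le> k j) \<Longrightarrow> U (\<Sum>j=1..p. \<beta> j) = (\<Sum>j=1..p. w j (\<beta> j))"
    and j12: "j1 \<in> {1..p}" "j2 \<in> {1..p}" "j1 \<noteq> j2" "k j1 \<ge> 1" "k j2 \<ge> 1"
  shows "\<exists>d. (\<forall>j\<in>{1..p}. \<forall>l\<le>k j. w j l = w j 0 + d * int l) \<and>
    (\<forall>m\<le>\<Sum>j=1..p. k j. U m = U 0 + d * int m) \<and> U 0 = (\<Sum>j=1..p. w j 0)"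
proof -
  have gap: "w j (Suc x) - w j x = w l (Suc y) - w l y"
    if jl: "j \<in> {1..p}" "l \<in> {1..p}" "j \<noteq> l" and xy: "x < k j" "y < k l" for j l x y
  proof -
    define \<beta> where "\<beta> = (\<lambda>u v. (\<lambda>_. 0 :: nat)(j := u, l := v))"
    have eval: "U (u + v) = w j u + w l v + (\<Sum>i\<in>{1..p} - {j, l}. w i 0)" if "u \<le> k j" "v \<le> k l" for u v
    proof -
      have "(\<Sum>i=1..p. \<beta> u v i) = u + v + (\<Sum>i\<in>{1..p} - {j, l}. \<beta> u v i)"
        using jl by (subst sum_two_slots[of _ j l]) (auto simp: \<beta>_def)
      moreover have "(\<Sum>i\<in>{1..p} - {j, l}. \<beta> u v i) = 0"
        by (intro sum.neutral) (auto simp: \<beta>_def)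
      moreover have "(\<Sum>i=1..p. w i (\<beta> u v i)) = w j u + w l v + (\<Sum>i\<in>{1..p} - {j, l}. w i (\<beta> u v i))"
        using jl by (subst sum_two_slots[of _ j l]) (auto simp: \<beta>_def)
      moreover have "(\<Sum>i\<in>{1..p} - {j, l}. w i (\<beta> u v i)) = (\<Sum>i\<in>{1..p} - {j, l}. w i 0)"
        by (intro sum.cong) (auto simp: \<beta>_def)
      moreover have "\<beta> u v i \<le> k i" if "i \<in> {1..p}" for i
        using \<open>u \<le> k j\<close> \<open>v \<le> k l\<close> by (simp add: \<beta>_def)
      ultimately show ?thesis
        using add[of "\<beta> u v"] by simp
    qed
    show ?thesis
      using eval[of "Suc x" y] eval[of x "Suc y"] xy by simp
  qed
  define d where "d = w j1 1 - w j1 0"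
  have step: "w j (Suc l) - w j l = d" if "j \<in> {1..p}" "l < k j" for j l
  proof (cases "j = j1")
    case True
    then show ?thesis
      using gap[of j1 j2 l 0] gap[of j1 j2 0 0] that j12 by (simp add: d_def)
  next
    case False
    then show ?thesis
      using gap[of j j1 l 0] that j12 by (simp add: d_def)
  qed
  have aff: "w j l = w j 0 + d * int l" if "j \<in> {1..p}" "l \<le> k j" for j l
    using that(2)
  proof (induction l)
    case (Suc l)
    then show ?case
      using step[OF that(1), of l] by (simp add: algebra_simps)
  qed simp
  have U0: "U 0 = (\<Sum>j=1..p. w j 0)"
    using add[of "\<lambda>_. 0"] by simp
  have affU: "U m = U 0 + d * int m" if m: "m \<le> (\<Sum>j=1..p. k j)" for m
  proof -
    obtain \<beta> where \<beta>: "\<forall>j\<in>{1..p}. \<beta> j \<le> k j" "(\<Sum>j=1..p. \<beta> j) = m"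
      using index_with_sum[OF _ m] by auto
    have "(\<Sum>j=1..p. w j (\<beta> j)) = (\<Sum>j=1..p. w j 0 + d * int (\<beta> j))"
      using \<beta> by (intro sum.cong aff) auto
    also have "\<dots> = (\<Sum>j=1..p. w j 0) + d * int m"
      by (simp add: sum.distrib sum_distrib_left[symmetric] \<beta>(2)[symmetric])
    finally show ?thesis
      using add[of \<beta>] \<beta> U0 by simp
  qed
  show ?thesis
    by (intro exI[of _ d] conjI ballI allI impI aff affU U0)
qed

lemma is_basis_unit_vec: "is_basis n (unit_vec n)"
proof -
  have "frame_mat n (unit_vec n) = 1\<^sub>m n"
    by (intro eq_matI) (auto simp: frame_mat_def)
  then show ?thesis
    by (auto simp: is_basis_iff_det)
qed

text \<open>
  All slots except \<open>0\<close> and \<open>j0\<close> are one-dimensional, and \<open>A\<close> is a square matrix. A vector in its kernel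
  would be a zero of the contraction, so the columns of the matrix form a basis of \<open>V\<^sub>0\<close>. Together with
  the unit vectors in the other slots they turn \<open>A\<close> into the identity matrix. Torus weights cannot be
  used here: they may have multiplicities and need not form a progression.
\<close>

lemma single_factor_diagonalizable:
  assumes k0: "k 0 = (\<Sum>i=1..p. k i)"
    and A: "A \<in> tensors p k" and nondeg: "A \<notin> segre_dual_variety p k"
    and j0: "j0 \<in> {1..p}" and triv: "\<And>j. j \<in> {1..p} \<Longrightarrow> j \<noteq> j0 \<Longrightarrow> k j = 0"
  shows "diagonalizable p k A"
proof -
  have sum_j0: "(\<Sum>j=1..p. f j) = f j0" if "\<And>j. j \<in> {1..p} \<Longrightarrow> j \<noteq> j0 \<Longrightarrow> f j = 0" for f :: "nat \<Rightarrow> nat"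
    using j0 that by (subst sum.remove[of _ j0]) auto
  have kk: "k 0 = k j0"
    using sum_j0[of k] triv k0 by simp
  define s where "s = (\<lambda>r c. slot_index p r ((\<lambda>_. 0)(j0 := c)))"
  have s_mem: "s r c \<in> multi_indices p k" if "r \<le> k 0" "c \<le> k 0" for r c
    unfolding s_def using that kk by (intro slot_index_in_multi_indices) auto
  have s_eq: "i = s (i 0) (i j0)" if i: "i \<in> multi_indices p k" for i
  proof
    fix j
    show "i j = s (i 0) (i j0) j"
    proof (cases "j \<le> p")
      case True
      then show ?thesis
        using triv[of j] multi_indices_le[OF i True] by (auto simp: s_def slot_index_def)
    next
      case False
      then show ?thesis
        using i by (auto simp: s_def slot_index_def multi_indices_def PiE_def extensional_def)
    qed
  qed
  have s_j0: "s r c j0 = c" "s r c 0 = r" for r c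
    using j0 by (auto simp: s_def)
  define col where "col = (\<lambda>c. vec (k 0 + 1) (\<lambda>r. A (s r c)))"
  have "det (frame_mat (k 0 + 1) col) \<noteq> 0"
  proof
    assume "det (frame_mat (k 0 + 1) col) = 0"
    then obtain v where v: "v \<in> carrier_vec (k 0 + 1)" "v \<noteq> 0\<^sub>v (k 0 + 1)" "frame_mat (k 0 + 1) col *\<^sub>v v = 0\<^sub>v (k 0 + 1)"
      using det_0_iff_vec_prod_zero[OF frame_mat_carrier] by blast
    define x where "x = (\<lambda>j. if j = j0 then v else vec (k j + 1) (\<lambda>_. 1))"
    have xc: "x j \<in> carrier_vec (k j + 1) \<and> x j \<noteq> 0\<^sub>v (k j + 1)" if "j \<in> {1..p}" for j
    proof (cases "j = j0")
      case False
      have "vec (k j + 1) (\<lambda>_. 1 :: complex) $ 0 \<noteq> 0\<^sub>v (k j + 1) $ 0"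
        by simp
      then show ?thesis
        using False unfolding x_def by (metis vec_carrier)
    qed (use v kk in \<open>simp add: x_def\<close>)
    have "contraction p k A (\<lambda>j l. x j $ l) r = 0" if r: "r \<le> k 0" for r
    proof -
      have "contraction p k A (\<lambda>j l. x j $ l) r = (\<Sum>c\<le>k 0. A (s r c) * v $ c)"
        unfolding contraction_def
      proof (rule sum.reindex_bij_witness[where i = "s r" and j = "\<lambda>i. i j0"])
        fix i assume i: "i \<in> {i \<in> multi_indices p k. i 0 = r}"
        then show "s r (i j0) = i" "i j0 \<in> {..k 0}"
          using s_eq[of i] multi_indices_le[of i p k j0] j0 kk by auto
        have "(\<Prod>j=1..p. x j $ i j) = x j0 $ i j0 * (\<Prod>j\<in>{1..p} - {j0}. x j $ i j)"
          using j0 by (intro prod.remove) auto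
        also have "(\<Prod>j\<in>{1..p} - {j0}. x j $ i j) = 1"
          using i multi_indices_le[of i p k] by (intro prod.neutral) (auto simp: x_def less_Suc_eq_le)
        finally show "A (s r (i j0)) * v $ i j0 = A i * (\<Prod>j=1..p. x j $ i j)"
          using i s_eq[of i] by (simp add: x_def)
      next
        fix c assume "c \<in> {..k 0}"
        then show "s r c j0 = c" "s r c \<in> {i \<in> multi_indices p k. i 0 = r}"
          using s_mem r by (auto simp: s_j0)
      qed
      also have "\<dots> = (frame_mat (k 0 + 1) col *\<^sub>v v) $ r"
        using r v(1) by (simp add: frame_mat_def scalar_prod_def col_def lessThan_Suc_atMost[symmetric] lessThan_atLeast0)
      finally show ?thesis
        using v(3) r by simp
    qed
    then obtain z where "z \<in> carrier_vec (k 0 + 1)" "z \<noteq> 0\<^sub>v (k 0 + 1)" "tangent_at p k A (x(0 := z))"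
      using contraction_zero_imp_tangent[where k = k and p = p and x = x, OF k0 xc] by blast
    moreover from this have "\<forall>j\<le>p. (x(0 := z)) j \<in> carrier_vec (k j + 1) \<and> (x(0 := z)) j \<noteq> 0\<^sub>v (k j + 1)"
      using xc by auto
    ultimately show False
      using degenerate_in_segre_dual_variety[OF A] nondeg by blast
  qed
  then have basis0: "is_basis (k 0 + 1) col"
    by (auto simp: is_basis_iff_det col_def)
  define e where "e = (\<lambda>j. if j = 0 then col else unit_vec (k j + 1))"
  define a :: tensor where "a = (\<lambda>i. if i 0 = (\<Sum>t=1..p. i t) then 1 else 0)"
  have "A r = (\<Sum>i\<in>multi_indices p k. a i * pure_tensor p k (\<lambda>j. e j (i j)) r)" for r
  proof (cases "r \<in> multi_indices p k")
    case r: True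
    let ?i = "s (r j0) (r j0)"
    have le: "r j0 \<le> k 0" "r 0 \<le> k 0"
      using multi_indices_le[OF r, of j0] multi_indices_le[OF r, of 0] j0 kk by auto
    have "a i * pure_tensor p k (\<lambda>j. e j (i j)) r = 0" if i: "i \<in> multi_indices p k" "i \<noteq> ?i" for i
    proof (cases "i j0 = r j0")
      case True
      have "i 0 \<noteq> (\<Sum>t=1..p. i t)"
      proof
        assume "i 0 = (\<Sum>t=1..p. i t)"
        also have "\<dots> = i j0"
          using triv multi_indices_le[OF i(1)] by (intro sum_j0) fastforce
        finally show False
          using s_eq[OF i(1)] True i(2) by simp
      qed
      then show ?thesis
        by (simp add: a_def)
    next
      case False
      then have "e j0 (i j0) $ r j0 = 0"
        using j0 multi_indices_le[OF i(1), of j0] multi_indices_le[OF r, of j0] by (auto simp: e_def)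
      then have "(\<Prod>j\<le>p. e j (i j) $ r j) = 0"
        using j0 by (intro prod_zero) auto
      then show ?thesis
        by (simp add: pure_tensor_def)
    qed
    then have "(\<Sum>i\<in>multi_indices p k. a i * pure_tensor p k (\<lambda>j. e j (i j)) r) =
        (\<Sum>i\<in>{?i}. a i * pure_tensor p k (\<lambda>j. e j (i j)) r)"
      using s_mem le by (intro sum.mono_neutral_right) auto
    also have "\<dots> = a ?i * (\<Prod>j\<le>p. e j (?i j) $ r j)"
      using r by (simp add: pure_tensor_def)
    also have "a ?i = 1"
      using sum_j0[of ?i] by (simp add: a_def s_j0) (auto simp: s_def)
    also have "(\<Prod>j\<le>p. e j (?i j) $ r j) = e 0 (?i 0) $ r 0 * (\<Prod>j=1..p. e j (?i j) $ r j)"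
      unfolding atMost_eq_insert_0 by (subst prod.insert) auto
    also have "(\<Prod>j=1..p. e j (?i j) $ r j) = 1"
    proof (intro prod.neutral ballI)
      fix j assume j: "j \<in> {1..p}"
      have "?i j = r j"
        using triv[OF j] multi_indices_le[OF r, of j] j by (cases "j = j0") (auto simp: s_def)
      then show "e j (?i j) $ r j = 1"
        using j multi_indices_le[OF r, of j] by (simp add: e_def)
    qed
    also have "e 0 (?i 0) $ r 0 = A r"
      using le s_eq[OF r] by (simp add: e_def col_def s_j0)
    finally show ?thesis
      by simp
  qed (use A in \<open>auto simp: tensors_def pure_tensor_def\<close>)
  then have "A = (\<lambda>r. \<Sum>i\<in>multi_indices p k. a i * pure_tensor p k (\<lambda>j. e j (i j)) r)"
    by blast
  moreover have "\<forall>j\<le>p. is_basis (k j + 1) (e j)"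
    using basis0 is_basis_unit_vec by (simp add: e_def)
  moreover have "\<forall>i\<in>multi_indices p k. i 0 \<noteq> (\<Sum>t=1..p. i t) \<longrightarrow> a i = 0"
    by (simp add: a_def)
  ultimately show ?thesis
    unfolding diagonalizable_def by blast
qed

section \<open>Diagonal one-parameter subgroups\<close>

lemma prod_power_int:
  fixes t :: "'a :: field"
  assumes "t \<noteq> 0"
  shows "(\<Prod>j\<in>S. t powi f j) = t powi (\<Sum>j\<in>S. f j)"
  by (induction S rule: infinite_finite_induct) (use assms in \<open>auto simp: power_int_add\<close>)

lemma two_powi_inject:
  assumes "(2 :: complex) powi m = 2 powi n"
  shows "m = n"
proof -
  have "norm ((2 :: complex) powi m) = norm ((2 :: complex) powi n)"
    using assms by simp
  then have "(2 :: real) powi m = 2 powi n"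
    by (simp add: norm_power_int)
  then show ?thesis
    by (metis linorder_neqE_linordered_idom one_less_numeral_iff order_less_irrefl power_int_strict_increasing semiring_norm(76))
qed

definition weight_mat :: "nat \<Rightarrow> (nat \<Rightarrow> int) \<Rightarrow> complex \<Rightarrow> complex mat" where
  "weight_mat n u t = mat n n (\<lambda>(r, c). if r = c then t powi u r else 0)"

lemma weight_mat_carrier [simp]: "weight_mat n u t \<in> carrier_mat n n"
  by (simp add: weight_mat_def)

lemma weight_mat_index [simp]:
  "r < n \<Longrightarrow> c < n \<Longrightarrow> weight_mat n u t $$ (r, c) = (if r = c then t powi u r else 0)"
  by (simp add: weight_mat_def)

lemma weight_mat_dim [simp]: "dim_row (weight_mat n u t) = n" "dim_col (weight_mat n u t) = n"
  by (simp_all add: weight_mat_def)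

lemma mult_weight_mat_index:
  assumes "M \<in> carrier_mat n n" "r < n" "c < n"
  shows "(M * weight_mat n u t) $$ (r, c) = M $$ (r, c) * t powi u c"
proof -
  have "(M * weight_mat n u t) $$ (r, c) = (\<Sum>l<n. M $$ (r, l) * (if l = c then t powi u l else 0))"
    using assms by (simp add: mat_mult_index_sum[of _ n] del: index_mult_mat(1))
  also have "\<dots> = (\<Sum>l<n. if l = c then M $$ (r, c) * t powi u c else 0)"
    by (intro sum.cong) auto
  finally show ?thesis
    using assms by simp
qed

lemma weight_mat_mult:
  assumes "s \<noteq> 0" "t \<noteq> 0"
  shows "weight_mat n u (s * t) = weight_mat n u s * weight_mat n u t"
  by (intro eq_matI) (auto simp: mult_weight_mat_index power_int_mult_distrib simp del: index_mult_mat(1))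

lemma det_weight_mat:
  assumes "t \<noteq> 0"
  shows "det (weight_mat n u t) = t powi (\<Sum>l<n. u l)"
proof -
  have "det (weight_mat n u t) = prod_list (diag_mat (weight_mat n u t))"
    by (intro det_upper_triangular) auto
  also have "\<dots> = (\<Prod>l<n. t powi u l)"
    by (simp add: prod_list_diag_prod lessThan_atLeast0)
  finally show ?thesis
    using assms by (simp add: prod_power_int)
qed

lemma tensor_act_weight_mat:
  assumes "i \<in> multi_indices p k" "t \<noteq> 0"
  shows "tensor_act p k (\<lambda>j. weight_mat (k j + 1) (w j) t) a i = t powi (\<Sum>j\<le>p. w j (i j)) * a i"
  using assms by (subst tensor_act_diagonal[where d = "\<lambda>j l. t powi w j l"]) (auto simp: prod_power_int)

lemma tensor_act_inverse:
  assumes "\<And>j. j \<le> p \<Longrightarrow> g j \<in> carrier_mat (k j + 1) (k j + 1)"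
    and "\<And>j. j \<le> p \<Longrightarrow> h j \<in> carrier_mat (k j + 1) (k j + 1)"
    and "\<And>j. j \<le> p \<Longrightarrow> g j * h j = 1\<^sub>m (k j + 1)"
    and "A \<in> tensors p k"
  shows "tensor_act p k g (tensor_act p k h A) = A"
proof -
  have "tensor_act p k g (tensor_act p k h A) = tensor_act p k (\<lambda>j. g j * h j) A"
    using assms by (intro tensor_act_mult)
  also have "\<dots> = tensor_act p k (\<lambda>j. 1\<^sub>m (k j + 1)) A"
    using assms by (intro tensor_act_cong)
  also have "\<dots> = A"
    using assms by (intro tensor_act_one)
  finally show ?thesis .
qed

lemma cpoly_eval_cong:
  assumes "\<And>v. v \<in> cpoly_vars P \<Longrightarrow> a v = b v"
  shows "cpoly_eval P a = cpoly_eval P b"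
proof -
  have "a v = b v" if "m \<in> Poly_Mapping.keys P" "v \<in> Poly_Mapping.keys m" for m v
    using that by (intro assms) (auto simp: cpoly_vars_def)
  then show ?thesis
    unfolding cpoly_eval_def by (intro sum.cong refl arg_cong2[of _ _ _ _ "(*)"] prod.cong) auto
qed

lemma cpoly_eval_superset:
  assumes "finite K" "Poly_Mapping.keys P \<subseteq> K"
  shows "cpoly_eval P a =
    (\<Sum>m\<in>K. Poly_Mapping.lookup P m * (\<Prod>v\<in>Poly_Mapping.keys m. a v ^ Poly_Mapping.lookup m v))"
  unfolding cpoly_eval_def using assms by (intro sum.mono_neutral_left) (auto simp: in_keys_iff)

lemma cpoly_eval_add: "cpoly_eval (P + Q) a = cpoly_eval P a + cpoly_eval Q a"
proof -
  let ?K = "Poly_Mapping.keys P \<union> Poly_Mapping.keys Q"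
  have "Poly_Mapping.keys (P + Q) \<subseteq> ?K"
    by (rule Poly_Mapping.keys_add)
  then show ?thesis
    by (simp add: cpoly_eval_superset[of ?K] lookup_add algebra_simps sum.distrib)
qed

lemma cpoly_eval_sum: "cpoly_eval (sum f S) a = (\<Sum>x\<in>S. cpoly_eval (f x) a)"
proof (induction S rule: infinite_finite_induct)
  case (insert x S)
  then show ?case
    by (simp add: cpoly_eval_add)
qed (auto simp: cpoly_eval_def)

definition linear_monomial :: "'v \<Rightarrow> complex \<Rightarrow> 'v cpoly" where
  "linear_monomial v c = Poly_Mapping.single (Poly_Mapping.single v 1) c"

lemma cpoly_eval_linear_monomial: "cpoly_eval (linear_monomial v c) a = c * a v"
  by (simp add: cpoly_eval_def linear_monomial_def)

lemma cpoly_vars_sum_linear_monomial: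
  "cpoly_vars (\<Sum>x\<in>S. linear_monomial (f x) (c x)) \<subseteq> f ` S"
proof -
  have "Poly_Mapping.keys (\<Sum>x\<in>S. linear_monomial (f x) (c x)) \<subseteq> (\<lambda>x. Poly_Mapping.single (f x) 1) ` S"
  proof (induction S rule: infinite_finite_induct)
    case (insert x S)
    have "Poly_Mapping.keys (linear_monomial (f x) (c x) + (\<Sum>x\<in>S. linear_monomial (f x) (c x))) \<subseteq>
        Poly_Mapping.keys (linear_monomial (f x) (c x)) \<union> Poly_Mapping.keys (\<Sum>x\<in>S. linear_monomial (f x) (c x))"
      by (rule Poly_Mapping.keys_add)
    moreover have "Poly_Mapping.keys (linear_monomial (f x) (c x)) \<subseteq> {Poly_Mapping.single (f x) 1}"
      by (simp add: linear_monomial_def)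
    ultimately show ?case
      using insert by auto
  qed auto
  then show ?thesis
    by (fastforce simp: cpoly_vars_def)
qed

lemma sum_arith_progression_centered: "(\<Sum>l<Suc n. 2 * int l - int n) = 0"
proof -
  have "(\<Sum>l<m. 2 * int l) = int m * (int m - 1)" for m
    by (induction m) (auto simp: algebra_simps)
  from this[of "Suc n"] show ?thesis
    by (simp add: sum_subtractf del: sum.lessThan_Suc)
qed

text \<open>
  The exponents \<open>2 l - k j\<close> have sum zero in every slot, which makes the determinants equal to 1. They
  are divided by 2 when all \<open>k j\<close> are even. Then some exponent is 1, so that the torus embeds as an
  algebraic group; without the division \<open>- 1\<close> would act trivially in the even case.
\<close>

lemma centered_torus_weights:
  fixes k :: "nat \<Rightarrow> nat"
  assumes k0: "k 0 = (\<Sum>j=1..p. k j)" and pos: "k 0 \<ge> 1"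
  shows "\<exists>(w :: nat \<Rightarrow> nat \<Rightarrow> int) j0 l0.
    (\<forall>j\<le>p. (\<Sum>l<k j + 1. w j l) = 0) \<and>
    (\<forall>i. i 0 = (\<Sum>t=1..p. i t) \<longrightarrow> (\<Sum>j\<le>p. w j (i j)) = 0) \<and>
    (\<forall>j\<le>p. \<forall>l\<le>k j. \<bar>w j l\<bar> \<le> int (k j)) \<and>
    j0 \<le> p \<and> l0 \<le> k j0 \<and> w j0 l0 = 1"
proof -
  define u where "u = (\<lambda>j l. if j = 0 then int (k 0) - 2 * int l else 2 * int l - int (k j))"
  define g :: int where "g = (if \<forall>j\<in>{1..p}. even (k j) then 2 else 1)"
  define w where "w = (\<lambda>j l. u j l div g)"
  have g: "g \<noteq> 0" "g \<ge> 1"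
    by (auto simp: g_def)
  have even0: "even (k 0)" if "\<forall>j\<in>{1..p}. even (k j)"
    unfolding k0 using that by (intro dvd_sum) auto
  have gw: "g * w j l = u j l" if "j \<le> p" for j l
  proof -
    have "g dvd u j l"
      using that even0 by (cases "j = 0") (auto simp: g_def u_def)
    then show ?thesis
      by (simp add: w_def)
  qed
  have sum0: "(\<Sum>l<k j + 1. w j l) = 0" if "j \<le> p" for j
  proof -
    have "g * (\<Sum>l<k j + 1. w j l) = (\<Sum>l<k j + 1. u j l)"
      using gw[OF that] by (simp add: sum_distrib_left del: sum.lessThan_Suc)
    also have "\<dots> = (if j = 0 then - 1 else 1) * (\<Sum>l<Suc (k j). 2 * int l - int (k j))"
      by (subst sum_distrib_left) (auto simp: u_def intro!: sum.cong)
    finally show ?thesis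
      using g sum_arith_progression_centered[of "k j"] by simp
  qed
  have wt0: "(\<Sum>j\<le>p. w j (i j)) = 0" if i: "i 0 = (\<Sum>t=1..p. i t)" for i
  proof -
    have "g * (\<Sum>j\<le>p. w j (i j)) = (\<Sum>j\<le>p. u j (i j))"
      using gw by (simp add: sum_distrib_left)
    also have "\<dots> = u 0 (i 0) + (\<Sum>j=1..p. u j (i j))"
      unfolding atMost_eq_insert_0 by (subst sum.insert) auto
    also have "(\<Sum>j=1..p. u j (i j)) = (\<Sum>j=1..p. 2 * int (i j) - int (k j))"
      by (intro sum.cong) (auto simp: u_def)
    also have "u 0 (i 0) + \<dots> = 0"
      by (simp add: u_def i k0 sum_subtractf sum_distrib_left)
    finally show ?thesis
      using g by simp
  qed
  have bound: "\<bar>w j l\<bar> \<le> int (k j)" if "j \<le> p" "l \<le> k j" for j l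
  proof -
    have "\<bar>w j l\<bar> \<le> g * \<bar>w j l\<bar>"
      using g mult_right_mono[of 1 g "\<bar>w j l\<bar>"] by simp
    also have "\<dots> = \<bar>u j l\<bar>"
      using g by (simp add: gw[OF that(1), symmetric] abs_mult)
    also have "\<dots> \<le> int (k j)"
      using that by (auto simp: u_def)
    finally show ?thesis .
  qed
  have "\<exists>j0 l0. j0 \<le> p \<and> l0 \<le> k j0 \<and> w j0 l0 = 1"
  proof (cases "\<forall>j\<in>{1..p}. even (k j)")
    case True
    then obtain m where m: "k 0 = 2 * m"
      using even0 by blast
    then have "u 0 (m - 1) = 2"
      using pos by (simp add: u_def of_nat_diff)
    then have "w 0 (m - 1) = 1"
      using True by (simp add: w_def g_def)
    then show ?thesis
      using m by (intro exI[of _ 0] exI[of _ "m - 1"]) auto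
  next
    case False
    then obtain j where j: "j \<in> {1..p}" "odd (k j)"
      by blast
    then obtain m where m: "k j = 2 * m + 1"
      using oddE by blast
    then have "w j (m + 1) = 1"
      using j False by (auto simp: w_def u_def g_def)
    then show ?thesis
      using m j by (intro exI[of _ j] exI[of _ "m + 1"]) auto
  qed
  then obtain j0 l0 where "j0 \<le> p" "l0 \<le> k j0" "w j0 l0 = 1"
    by blast
  with sum0 wt0 bound show ?thesis
    by (intro exI[of _ w] exI[of _ j0] exI[of _ l0] conjI allI impI)
qed

section \<open>Tori in the stabilizer\<close>

text \<open>
  The one-parameter subgroup is diagonal in the bases that diagonalize \<open>A\<close>; it fixes \<open>A\<close> because the
  weights cancel on the support. The parameter \<open>t\<close> is the diagonal entry of weight 1, a linear form in
  the entries of the matrix in standard coordinates.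
\<close>

lemma diagonalizable_imp_contains_Cstar:
  assumes k0: "k 0 = (\<Sum>j=1..p. k j)" and pos: "k 0 \<ge> 1" and diag: "diagonalizable p k A"
  shows "contains_Cstar p k (Stab p k A)"
proof -
  obtain e a where basis: "\<And>j. j \<le> p \<Longrightarrow> is_basis (k j + 1) (e j)"
    and A: "A = (\<lambda>r. \<Sum>i\<in>multi_indices p k. a i * pure_tensor p k (\<lambda>j. e j (i j)) r)"
    and supp: "\<And>i. i \<in> multi_indices p k \<Longrightarrow> i 0 \<noteq> (\<Sum>t=1..p. i t) \<Longrightarrow> a i = 0"
    using diag unfolding diagonalizable_def by blast
  define E where "E = (\<lambda>j. frame_mat (k j + 1) (e j))"
  have Ec: "E j \<in> carrier_mat (k j + 1) (k j + 1)" for j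
    by (simp add: E_def)
  have "\<exists>F. j \<le> p \<longrightarrow> F \<in> carrier_mat (k j + 1) (k j + 1) \<and> F * E j = 1\<^sub>m (k j + 1) \<and> E j * F = 1\<^sub>m (k j + 1)" for j
    using inverse_of_frame[OF basis[of j]] unfolding E_def by metis
  then obtain F where Fc: "\<And>j. j \<le> p \<Longrightarrow> F j \<in> carrier_mat (k j + 1) (k j + 1)"
    and FE: "\<And>j. j \<le> p \<Longrightarrow> F j * E j = 1\<^sub>m (k j + 1)" and EF: "\<And>j. j \<le> p \<Longrightarrow> E j * F j = 1\<^sub>m (k j + 1)"
    by metis
  have AE: "A = tensor_act p k E a"
    unfolding A E_def by (rule expansion_eq_tensor_act)
  obtain w :: "nat \<Rightarrow> nat \<Rightarrow> int" and j0 l0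
    where w: "(\<forall>j\<le>p. (\<Sum>l<k j + 1. w j l) = 0) \<and>
      (\<forall>i. i 0 = (\<Sum>t=1..p. i t) \<longrightarrow> (\<Sum>j\<le>p. w j (i j)) = 0) \<and>
      (\<forall>j\<le>p. \<forall>l\<le>k j. \<bar>w j l\<bar> \<le> int (k j)) \<and>
      j0 \<le> p \<and> l0 \<le> k j0 \<and> w j0 l0 = 1"
    using centered_torus_weights[OF k0 pos] by (elim exE)
  have sum0: "(\<Sum>l<k j + 1. w j l) = 0" if "j \<le> p" for j
    using conjunct1[OF w] that by (elim allE impE)
  have wt0: "(\<Sum>j\<le>p. w j (i j)) = 0" if "i 0 = (\<Sum>t=1..p. i t)" for i
    using conjunct1[OF conjunct2[OF w]] that by (elim allE impE)
  have bound: "\<bar>w j l\<bar> \<le> int (k j)" if "j \<le> p" "l \<le> k j" for j l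
    using conjunct1[OF conjunct2[OF conjunct2[OF w]]] that by (elim allE impE)
  have jl: "j0 \<le> p" "l0 \<le> k j0" "w j0 l0 = 1"
    using conjunct2[OF conjunct2[OF conjunct2[OF w]]] by simp_all
  define D where "D = (\<lambda>t j. weight_mat (k j + 1) (w j) t)"
  have Dc: "D t j \<in> carrier_mat (k j + 1) (k j + 1)" for t j
    by (simp add: D_def)
  define \<phi> where "\<phi> = (\<lambda>t. \<lambda>j\<in>{..p}. E j * D t j * F j)"
  have phi: "\<phi> t j = E j * D t j * F j" if "j \<le> p" for t j
    using that by (simp add: \<phi>_def)
  have phic: "\<phi> t j \<in> carrier_mat (k j + 1) (k j + 1)" if "j \<le> p" for t j
    using Ec[of j] Dc[of t j] Fc[OF that] by (simp add: phi[OF that])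
  have phiE: "\<phi> t j * E j = E j * D t j" if "j \<le> p" for t j
  proof -
    have "\<phi> t j * E j = E j * D t j * (F j * E j)"
      using Ec[of j] Dc[of t j] Fc[OF that] unfolding phi[OF that]
      by (intro assoc_mult_mat[of _ "k j + 1" "k j + 1" _ "k j + 1" _ "k j + 1"]) auto
    then show ?thesis
      using Ec[of j] Dc[of t j] FE[OF that] by simp
  qed
  have phi_mult: "\<phi> (s * t) j = \<phi> s j * \<phi> t j" if "j \<le> p" "s \<noteq> 0" "t \<noteq> 0" for s t j
  proof -
    let ?n = "k j + 1"
    note c = Ec[of j] Dc[of s j] Dc[of t j] Fc[OF that(1)] phic[OF that(1)]
    have "\<phi> s j * \<phi> t j = \<phi> s j * (E j * (D t j * F j))"
      using c by (simp add: phi[OF that(1), of t] assoc_mult_mat[of _ ?n ?n _ ?n _ ?n])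
    also have "\<dots> = \<phi> s j * E j * (D t j * F j)"
      using c by (intro assoc_mult_mat[of _ ?n ?n _ ?n _ ?n, symmetric]) auto
    also have "\<dots> = E j * (D s j * D t j) * F j"
      using c by (simp add: phiE[OF that(1)] assoc_mult_mat[of _ ?n ?n _ ?n _ ?n])
    also have "D s j * D t j = D (s * t) j"
      using that by (simp add: D_def weight_mat_mult)
    finally show ?thesis
      by (simp add: phi[OF that(1)])
  qed
  have phi_det: "det (\<phi> t j) = 1" if "j \<le> p" "t \<noteq> 0" for t j
  proof -
    note c = Ec[of j] Dc[of t j] Fc[OF that(1)]
    have "det (\<phi> t j) = det (E j) * det (D t j) * det (F j)"
      using c by (simp add: phi[OF that(1)] det_mult[of _ "k j + 1"])
    moreover have "det (E j) * det (F j) = 1"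
      using det_mult[OF c(1,3)] EF[OF that(1)] by simp
    moreover have "det (D t j) = 1"
      using that sum0[OF that(1)] unfolding D_def by (subst det_weight_mat) auto
    ultimately show ?thesis
      by simp
  qed
  have phi_car: "\<phi> t \<in> carrier (SL_product p k)" if "t \<noteq> 0" for t
    using phic phi_det that by (auto simp: SL_product_def SL_def \<phi>_def)
  have hom: "\<phi> \<in> hom Cstar (SL_product p k)"
  proof (rule homI)
    show "\<phi> t \<in> carrier (SL_product p k)" if "t \<in> carrier Cstar" for t
      using phi_car that by (simp add: Cstar_def)
    show "\<phi> (s \<otimes>\<^bsub>Cstar\<^esub> t) = \<phi> s \<otimes>\<^bsub>SL_product p k\<^esub> \<phi> t" if "s \<in> carrier Cstar" "t \<in> carrier Cstar" for s t
    proof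
      fix j show "\<phi> (s \<otimes>\<^bsub>Cstar\<^esub> t) j = (\<phi> s \<otimes>\<^bsub>SL_product p k\<^esub> \<phi> t) j"
        using phi_mult[of j s t] that by (cases "j \<le> p") (auto simp: Cstar_def SL_product_def SL_def \<phi>_def)
    qed
  qed
  have stab: "\<phi> t \<in> Stab p k A" if "t \<noteq> 0" for t
  proof -
    have "tensor_act p k (\<phi> t) A = tensor_act p k (\<lambda>j. \<phi> t j * E j) a"
      unfolding AE using phic Ec by (intro tensor_act_mult)
    also have "\<dots> = tensor_act p k (\<lambda>j. E j * D t j) a"
      using phiE by (intro tensor_act_cong)
    also have "\<dots> = tensor_act p k E (tensor_act p k (D t) a)"
      using Ec Dc by (intro tensor_act_mult[symmetric])
    also have "\<dots> = A"
    proof -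
      have "tensor_act p k (D t) a i = a i" if i: "i \<in> multi_indices p k" for i
      proof -
        have "tensor_act p k (D t) a i = t powi (\<Sum>j\<le>p. w j (i j)) * a i"
          unfolding D_def using i \<open>t \<noteq> 0\<close> by (rule tensor_act_weight_mat)
        then show ?thesis
          using supp[OF i] wt0[of i] by (cases "i 0 = (\<Sum>t=1..p. i t)") auto
      qed
      then show ?thesis
        unfolding AE tensor_act_def[of p k E] by (auto simp: fun_eq_iff)
    qed
    finally have "tensor_act p k (\<phi> t) A = (\<lambda>i. 1 * A i)"
      by simp
    then show ?thesis
      using phi_car[OF that] unfolding Stab_def by (intro CollectI conjI exI[of _ 1]) auto
  qed
  have laurent: "\<exists>(q :: complex poly) (N :: nat). \<forall>t\<in>carrier Cstar. \<phi> t j $$ (r, c) = poly q t / t ^ N"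
    if "j \<le> p" "r \<le> k j" "c \<le> k j" for j r c
  proof (intro exI ballI)
    fix t assume "t \<in> carrier Cstar"
    then have t: "t \<noteq> 0"
      by (simp add: Cstar_def)
    have "\<phi> t j $$ (r, c) = (\<Sum>l<k j + 1. (E j * D t j) $$ (r, l) * F j $$ (l, c))"
      unfolding phi[OF that(1)]
      by (rule mat_mult_index_sum) (use that Ec[of j] Dc[of t j] Fc[OF that(1)] in auto)
    also have "\<dots> = (\<Sum>l<k j + 1. E j $$ (r, l) * t powi w j l * F j $$ (l, c))"
    proof (intro sum.cong refl)
      fix l assume "l \<in> {..<k j + 1}"
      then have "(E j * D t j) $$ (r, l) = E j $$ (r, l) * t powi w j l"
        unfolding D_def using that Ec[of j] by (intro mult_weight_mat_index) auto
      then show "(E j * D t j) $$ (r, l) * F j $$ (l, c) = E j $$ (r, l) * t powi w j l * F j $$ (l, c)"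
        by simp
    qed
    also have "\<dots> = (\<Sum>l<k j + 1. E j $$ (r, l) * F j $$ (l, c) * t ^ nat (w j l + int (k j))) / t ^ k j"
      unfolding sum_divide_distrib
    proof (intro sum.cong refl)
      fix l assume "l \<in> {..<k j + 1}"
      then have "t powi (w j l + int (k j)) = t ^ nat (w j l + int (k j))"
        using bound[OF that(1), of l] by (simp add: power_int_def)
      then have "t powi w j l * t ^ k j = t ^ nat (w j l + int (k j))"
        using t by (simp add: power_int_add)
      then have "t powi w j l = t ^ nat (w j l + int (k j)) / t ^ k j"
        using t by (simp add: field_simps)
      then show "E j $$ (r, l) * t powi w j l * F j $$ (l, c) =
          E j $$ (r, l) * F j $$ (l, c) * t ^ nat (w j l + int (k j)) / t ^ k j"
        by simp
    qed
    also have "(\<Sum>l<k j + 1. E j $$ (r, l) * F j $$ (l, c) * t ^ nat (w j l + int (k j))) =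
        poly (\<Sum>l<k j + 1. Polynomial.monom (E j $$ (r, l) * F j $$ (l, c)) (nat (w j l + int (k j)))) t"
      by (simp add: poly_sum poly_monom del: sum.lessThan_Suc)
    finally show "\<phi> t j $$ (r, c) =
        poly (\<Sum>l<k j + 1. Polynomial.monom (E j $$ (r, l) * F j $$ (l, c)) (nat (w j l + int (k j)))) t / t ^ k j" .
  qed
  let ?n = "k j0 + 1"
  define P where "P = (\<Sum>(r, c)\<in>{..<?n} \<times> {..<?n}. linear_monomial (j0, r, c) (F j0 $$ (l0, r) * E j0 $$ (c, l0)))"
  have Pvars: "cpoly_vars P \<subseteq> {(j, r, c). j \<le> p \<and> r \<le> k j \<and> c \<le> k j}"
  proof -
    have "cpoly_vars P \<subseteq> (\<lambda>x. (j0, fst x, snd x)) ` ({..<?n} \<times> {..<?n})"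
      unfolding P_def case_prod_beta by (rule cpoly_vars_sum_linear_monomial)
    then show ?thesis
      using jl(1) by auto
  qed
  have Peval: "cpoly_eval P (\<lambda>(j, r, c). \<phi> t j $$ (r, c)) = t" if "t \<noteq> 0" for t
  proof -
    note c = Ec[of j0] Dc[of t j0] Fc[OF jl(1)] phic[OF jl(1), of t]
    have "cpoly_eval P (\<lambda>(j, r, c). \<phi> t j $$ (r, c)) =
        (\<Sum>r<?n. \<Sum>c<?n. F j0 $$ (l0, r) * E j0 $$ (c, l0) * \<phi> t j0 $$ (r, c))"
      unfolding P_def cpoly_eval_sum sum.cartesian_product
      by (intro sum.cong refl) (auto simp: cpoly_eval_linear_monomial)
    also have "\<dots> = (\<Sum>r<?n. F j0 $$ (l0, r) * (\<phi> t j0 * E j0) $$ (r, l0))"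
    proof (intro sum.cong refl)
      fix r assume "r \<in> {..<?n}"
      then have "(\<phi> t j0 * E j0) $$ (r, l0) = (\<Sum>c<?n. \<phi> t j0 $$ (r, c) * E j0 $$ (c, l0))"
        by (intro mat_mult_index_sum) (use c jl in auto)
      then show "(\<Sum>c<?n. F j0 $$ (l0, r) * E j0 $$ (c, l0) * \<phi> t j0 $$ (r, c)) = F j0 $$ (l0, r) * (\<phi> t j0 * E j0) $$ (r, l0)"
        by (simp add: sum_distrib_left mult_ac del: sum.lessThan_Suc)
    qed
    also have "\<dots> = (F j0 * (\<phi> t j0 * E j0)) $$ (l0, l0)"
      by (rule mat_mult_index_sum[symmetric]) (use c jl in auto)
    also have "F j0 * (\<phi> t j0 * E j0) = D t j0"
    proof -
      have "F j0 * (E j0 * D t j0) = F j0 * E j0 * D t j0"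
        using c by (intro assoc_mult_mat[of _ ?n ?n _ ?n _ ?n, symmetric]) auto
      then show ?thesis
        using c FE[OF jl(1)] by (simp add: phiE[OF jl(1)])
    qed
    also have "D t j0 $$ (l0, l0) = t"
      using jl by (simp add: D_def)
    finally show ?thesis .
  qed
  have Cstar: "t \<in> carrier Cstar \<longleftrightarrow> t \<noteq> 0" for t
    by (simp add: Cstar_def)
  have image: "\<phi> ` carrier Cstar \<subseteq> Stab p k A"
    using stab Cstar by blast
  have inverse: "\<forall>t\<in>carrier Cstar. cpoly_eval P (\<lambda>(j, r, c). \<phi> t j $$ (r, c)) = t"
    using Peval Cstar by blast
  show ?thesis
    unfolding contains_Cstar_def
    by (intro bexI[OF _ hom] conjI allI impI laurent exI[of _ P] Pvars image inverse)
qed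

text \<open>
  The condition on the support is read off from the single element \<open>\<phi> 2\<close>: since 2 is not a root of
  unity, its powers determine their exponents. The weights on \<open>V\<^sub>0\<close> are numbered decreasingly, because \<open>U\<close> is their negative up to a
  constant.
\<close>

lemma contains_Cstar_imp_diagonalizable:
  assumes k0: "k 0 = (\<Sum>j=1..p. k j)" and pos: "k 0 \<ge> 1"
    and At: "A \<in> tensors p k" and Anz: "A \<noteq> (\<lambda>i. 0)" and nondeg: "A \<notin> segre_dual_variety p k"
    and torus: "contains_Cstar p k (Stab p k A)"
  shows "diagonalizable p k A"
proof -
  obtain \<phi> P where hom: "\<phi> \<in> hom Cstar (SL_product p k)"
    and image: "\<phi> ` carrier Cstar \<subseteq> Stab p k A"
    and regular: "\<forall>j\<le>p. \<forall>r\<le>k j. \<forall>c\<le>k j. \<exists>(q :: complex poly) (N :: nat).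
        \<forall>t\<in>carrier Cstar. \<phi> t j $$ (r, c) = poly q t / t ^ N"
    and Pvars: "cpoly_vars P \<subseteq> {(j, r, c). j \<le> p \<and> r \<le> k j \<and> c \<le> k j}"
    and inverse: "\<forall>t\<in>carrier Cstar. cpoly_eval P (\<lambda>(j, r, c). \<phi> t j $$ (r, c)) = t"
    using torus unfolding contains_Cstar_def by blast
  have Cstar: "t \<in> carrier Cstar \<longleftrightarrow> t \<noteq> 0" for t
    by (simp add: Cstar_def)
  have img: "\<phi> t \<in> Stab p k A" if "t \<noteq> 0" for t
    using image that Cstar by blast
  have laurent: "\<exists>(q :: complex poly) (N :: nat). \<forall>t. t \<noteq> 0 \<longrightarrow> \<phi> t j $$ (r, c) = poly q t / t ^ N"
    if "j \<le> p" "r \<le> k j" "c \<le> k j" for j r c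
  proof -
    have "\<exists>(q :: complex poly) (N :: nat). \<forall>t\<in>carrier Cstar. \<phi> t j $$ (r, c) = poly q t / t ^ N"
      using regular that by (elim allE impE)
    then show ?thesis
      unfolding Ball_def Cstar .
  qed
  have Peval: "cpoly_eval P (\<lambda>(j, r, c). \<phi> t j $$ (r, c)) = t" if "t \<noteq> 0" for t
    using inverse that Cstar by blast
  have phi_car: "\<phi> t \<in> carrier (SL_product p k)" if "t \<noteq> 0" for t
    using img[OF that] by (simp add: Stab_def)
  have phic: "\<phi> t j \<in> carrier_mat (k j + 1) (k j + 1)" and phi_det: "det (\<phi> t j) = 1"
    if "j \<le> p" "t \<noteq> 0" for t j
    using phi_car[OF that(2)] that(1) by (auto simp: SL_product_def SL_def PiE_iff)
  have phi_mult: "\<phi> (s * t) j = \<phi> s j * \<phi> t j" if "j \<le> p" "s \<noteq> 0" "t \<noteq> 0" for s t j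
    using hom_mult[OF hom, of s t] that by (simp add: Cstar_def SL_product_def SL_def)
  have phi_one: "\<phi> 1 j = 1\<^sub>m (k j + 1)" if "j \<le> p" for j
  proof -
    note c = phic[OF that one_neq_zero]
    have "\<phi> 1 j \<in> Units (ring_mat TYPE(complex) (k j + 1) undefined)"
      using c phi_det[OF that one_neq_zero] by (intro det_non_zero_imp_unit) auto
    then obtain N where N: "N \<in> carrier_mat (k j + 1) (k j + 1)" "N * \<phi> 1 j = 1\<^sub>m (k j + 1)"
      by (auto simp: Units_def ring_mat_def)
    have "1\<^sub>m (k j + 1) = N * (\<phi> 1 j * \<phi> 1 j)"
      using N phi_mult[OF that, of 1 1] by simp
    also have "\<dots> = N * \<phi> 1 j * \<phi> 1 j"
      using N(1) c by (intro assoc_mult_mat[symmetric]) auto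
    finally show ?thesis
      using N c by simp
  qed
  define weight_basis where "weight_basis = (\<lambda>j e (w :: nat \<Rightarrow> int). is_basis (k j + 1) e \<and>
    (\<forall>i t. i < k j + 1 \<longrightarrow> t \<noteq> 0 \<longrightarrow> \<phi> t j *\<^sub>v e i = (t powi w i) \<cdot>\<^sub>v e i) \<and>
    (\<forall>i i'. i \<le> i' \<longrightarrow> i' < k j + 1 \<longrightarrow> (if j = 0 then - 1 else 1) * w i \<le> (if j = 0 then - 1 else 1) * w i'))"
  have "\<exists>e w. weight_basis j e w" if j: "j \<le> p" for j
  proof (rule torus_representation_weight_basis[of "\<lambda>t. \<phi> t j" "k j + 1" "if j = 0 then - 1 else 1"])
    show "\<phi> t j \<in> carrier_mat (k j + 1) (k j + 1)" if "t \<noteq> 0" for t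
      by (rule phic[OF j that])
    show "\<phi> (t * s) j = \<phi> t j * \<phi> s j" if "s \<noteq> 0" "t \<noteq> 0" for s t
      by (rule phi_mult[OF j that(2,1)])
    show "\<phi> 1 j = 1\<^sub>m (k j + 1)"
      by (rule phi_one[OF j])
    show "\<exists>(q :: complex poly) (N :: nat). \<forall>t. t \<noteq> 0 \<longrightarrow> \<phi> t j $$ (r, c) = poly q t / t ^ N"
      if "r < k j + 1" "c < k j + 1" for r c
      by (rule laurent[OF j]) (use that in linarith)+
  next
    fix e and w :: "nat \<Rightarrow> int"
    assume "is_basis (k j + 1) e"
      and "\<And>i t. i < k j + 1 \<Longrightarrow> t \<noteq> 0 \<Longrightarrow> \<phi> t j *\<^sub>v e i = (t powi w i) \<cdot>\<^sub>v e i"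
      and "\<And>i i'. i \<le> i' \<Longrightarrow> i' < k j + 1 \<Longrightarrow> (if j = 0 then - 1 else 1) * w i \<le> (if j = 0 then - 1 else 1) * w i'"
    then show ?thesis
      unfolding weight_basis_def by (intro exI[of _ e] exI[of _ w] conjI allI impI)
  qed
  then obtain e w where weight_basis: "\<And>j. j \<le> p \<Longrightarrow> weight_basis j (e j) (w j)"
    by metis
  note ew = weight_basis[unfolded weight_basis_def]
  have basis: "is_basis (k j + 1) (e j)" if "j \<le> p" for j
    using ew[OF that] by blast
  have eigen: "\<phi> t j *\<^sub>v e j i = (t powi w j i) \<cdot>\<^sub>v e j i" if "j \<le> p" "i \<le> k j" "t \<noteq> 0" for i j t
    using ew[OF that(1)] that by simp
  define E where "E = (\<lambda>j. frame_mat (k j + 1) (e j))"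
  have Ec: "E j \<in> carrier_mat (k j + 1) (k j + 1)" for j
    by (simp add: E_def)
  have "\<exists>F. j \<le> p \<longrightarrow> F \<in> carrier_mat (k j + 1) (k j + 1) \<and> F * E j = 1\<^sub>m (k j + 1) \<and> E j * F = 1\<^sub>m (k j + 1)" for j
    using inverse_of_frame[OF basis[of j]] unfolding E_def by metis
  then obtain F where Fc: "\<And>j. j \<le> p \<Longrightarrow> F j \<in> carrier_mat (k j + 1) (k j + 1)"
    and FE: "\<And>j. j \<le> p \<Longrightarrow> F j * E j = 1\<^sub>m (k j + 1)" and EF: "\<And>j. j \<le> p \<Longrightarrow> E j * F j = 1\<^sub>m (k j + 1)"
    by metis
  define D where "D = (\<lambda>t j. weight_mat (k j + 1) (w j) t)"
  have Dc: "D t j \<in> carrier_mat (k j + 1) (k j + 1)" for t j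
    by (simp add: D_def)
  have phiE: "\<phi> t j * E j = E j * D t j" if "j \<le> p" "t \<noteq> 0" for t j
  proof (rule eq_matI)
    fix r c assume "r < dim_row (E j * D t j)" "c < dim_col (E j * D t j)"
    then have rc: "r < k j + 1" "c < k j + 1"
      using Ec[of j] by (auto simp: D_def)
    have ec: "e j c \<in> carrier_vec (k j + 1)"
      using basis[OF that(1)] rc by (auto simp: is_basis_iff_det)
    have "(\<phi> t j * E j) $$ (r, c) = (\<Sum>l<k j + 1. \<phi> t j $$ (r, l) * E j $$ (l, c))"
      by (rule mat_mult_index_sum) (use phic[OF that] Ec[of j] rc in auto)
    also have "\<dots> = (\<Sum>l<k j + 1. \<phi> t j $$ (r, l) * e j c $ l)"
      using rc by (intro sum.cong) (auto simp: E_def)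
    also have "\<dots> = (\<phi> t j *\<^sub>v e j c) $ r"
      using phic[OF that] rc ec by (simp add: scalar_prod_def lessThan_atLeast0)
    also have "\<dots> = t powi w j c * e j c $ r"
      using eigen[OF that(1) _ that(2), of c] rc ec by simp
    also have "\<dots> = (E j * D t j) $$ (r, c)"
      unfolding D_def mult_weight_mat_index[OF Ec rc] using rc by (simp add: E_def)
    finally show "(\<phi> t j * E j) $$ (r, c) = (E j * D t j) $$ (r, c)" .
  qed (use phic[OF that] Ec[of j] Dc[of t j] in auto)
  define a where "a = tensor_act p k F A"
  have AE: "A = tensor_act p k E a"
    unfolding a_def using Ec Fc EF At by (intro tensor_act_inverse[symmetric]) auto
  have "\<exists>c. \<forall>i\<in>multi_indices p k. (2 :: complex) powi (\<Sum>j\<le>p. w j (i j)) * a i = c * a i"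
  proof -
    obtain c where c: "tensor_act p k (\<phi> 2) A = (\<lambda>i. c * A i)"
      using img[of 2] by (auto simp: Stab_def)
    have "tensor_act p k (\<phi> 2) A = tensor_act p k (\<lambda>j. \<phi> 2 j * E j) a"
      unfolding AE using phic Ec by (intro tensor_act_mult) auto
    also have "\<dots> = tensor_act p k (\<lambda>j. E j * D 2 j) a"
      using phiE by (intro tensor_act_cong) auto
    also have "\<dots> = tensor_act p k E (tensor_act p k (D 2) a)"
      using Ec Dc by (intro tensor_act_mult[symmetric])
    finally have "tensor_act p k F (\<lambda>i. c * A i) = tensor_act p k (D 2) a"
      using c Ec Fc FE by (simp add: tensor_act_inverse)
    moreover have "tensor_act p k F (\<lambda>i. c * A i) i = c * a i" for i
      by (simp add: a_def tensor_act_def sum_distrib_left mult_ac)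
    ultimately have "tensor_act p k (D 2) a i = c * a i" for i
      by metis
    then show ?thesis
      unfolding D_def by (intro exI[of _ c] ballI) (simp add: tensor_act_weight_mat[symmetric])
  qed
  then obtain c where eigen_a: "\<forall>i\<in>multi_indices p k. (2 :: complex) powi (\<Sum>j\<le>p. w j (i j)) * a i = c * a i"
    by (rule exE)
  have c: "(2 :: complex) powi (\<Sum>j\<le>p. w j (i j)) = c" if "i \<in> multi_indices p k" "a i \<noteq> 0" for i
    using bspec[OF eigen_a that(1)] that(2) by (simp only: mult_cancel_right simp_thms)
  have "\<exists>i\<in>multi_indices p k. a i \<noteq> 0"
  proof (rule ccontr)
    assume "\<not> ?thesis"
    then have "tensor_act p k E a = (\<lambda>i. 0)"
      by (auto simp: tensor_act_def fun_eq_iff)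
    then show False
      using AE Anz by simp
  qed
  then obtain i1 where i1: "i1 \<in> multi_indices p k" "a i1 \<noteq> 0"
    by blast
  define W where "W = (\<Sum>j\<le>p. w j (i1 j))"
  \<comment> \<open>\<open>W\<close> is the weight by which the torus scales \<open>A\<close>; the stabilizer is that of a projective point.\<close>
  define U where "U = (\<lambda>r. W - w 0 r)"
  have supp: "U (i 0) = (\<Sum>j=1..p. w j (i j))" if "i \<in> multi_indices p k" "a i \<noteq> 0" for i
  proof -
    have "(\<Sum>j\<le>p. w j (i j)) = W"
      unfolding W_def using c[OF that] c[OF i1] by (intro two_powi_inject) simp
    moreover have "(\<Sum>j\<le>p. w j (i j)) = w 0 (i 0) + (\<Sum>j=1..p. w j (i j))"
      unfolding atMost_eq_insert_0 by (subst sum.insert) auto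
    ultimately show ?thesis
      by (simp add: U_def)
  qed
  have monoU: "U r \<le> U s" if "r \<le> s" "s \<le> k 0" for r s
    using ew[of 0] that by (simp add: U_def)
  have monow: "w j r \<le> w j s" if "j \<in> {1..p}" "r \<le> s" "s \<le> k j" for j r s
    using ew[of j] that by simp
  have additive: "U (\<Sum>j=1..p. \<beta> j) = (\<Sum>j=1..p. w j (\<beta> j))" if "\<And>j. j \<in> {1..p} \<Longrightarrow> \<beta> j \<le> k j" for \<beta>
  proof (rule weights_additive[where a = a and E = E and F = F and k = k, OF k0 Ec Fc FE])
    show "tensor_act p k E a \<notin> segre_dual_variety p k"
      using nondeg AE by simp
  qed (assumption | erule (1) monoU | erule (2) monow | erule (1) supp | erule that)+
  obtain j1 where j1: "j1 \<in> {1..p}" "k j1 \<ge> 1"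
  proof -
    have "\<exists>j\<in>{1..p}. k j \<noteq> 0"
    proof (rule ccontr)
      assume "\<not> ?thesis"
      then have "(\<Sum>j=1..p. k j) = 0"
        by (intro sum.neutral) blast
      then show False
        using pos k0 by simp
    qed
    then obtain j where "j \<in> {1..p}" "k j \<noteq> 0"
      by blast
    then show ?thesis
      by (intro that[of j]) auto
  qed
  show ?thesis
  proof (cases "\<exists>j2\<in>{1..p}. j2 \<noteq> j1 \<and> k j2 \<ge> 1")
    case False
    then have "k j = 0" if "j \<in> {1..p}" "j \<noteq> j1" for j
      using that by (metis less_one linorder_not_less)
    then show ?thesis
      using single_factor_diagonalizable[OF k0 At nondeg j1(1)] by blast
  next
    case True
    then obtain j2 where j2: "j2 \<in> {1..p}" "j1 \<noteq> j2" "k j2 \<ge> 1"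
      by blast
    have "\<exists>d. (\<forall>j\<in>{1..p}. \<forall>l\<le>k j. w j l = w j 0 + d * int l) \<and>
        (\<forall>m\<le>\<Sum>j=1..p. k j. U m = U 0 + d * int m) \<and> U 0 = (\<Sum>j=1..p. w j 0)"
    proof (rule additive_weights_affine)
      show "U (\<Sum>j=1..p. \<beta> j) = (\<Sum>j=1..p. w j (\<beta> j))" if "\<And>j. j \<in> {1..p} \<Longrightarrow> \<beta> j \<le> k j" for \<beta>
        using that by (rule additive)
    qed (fact j1 j2)+
    then obtain d where d: "(\<forall>j\<in>{1..p}. \<forall>l\<le>k j. w j l = w j 0 + d * int l) \<and>
        (\<forall>m\<le>\<Sum>j=1..p. k j. U m = U 0 + d * int m) \<and> U 0 = (\<Sum>j=1..p. w j 0)"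
      by (rule exE)
    have aff: "w j l = w j 0 + d * int l" if "j \<in> {1..p}" "l \<le> k j" for j l
      by (rule conjunct1[OF d, rule_format]) (fact that)+
    have affU: "U m = U 0 + d * int m" if "m \<le> k 0" for m
      by (rule conjunct1[OF conjunct2[OF d], rule_format]) (use that k0 in simp)
    have U0: "U 0 = (\<Sum>j=1..p. w j 0)"
      using conjunct2[OF conjunct2[OF d]] .
    \<comment> \<open>For \<open>d = 0\<close> every \<open>\<phi> t j\<close> is a scalar matrix \<open>t\<^bsup>w\<^esup>\<close> of determinant 1, so \<open>w = 0\<close> and \<open>\<phi>\<close> is trivial.\<close>
    have "d \<noteq> 0"
    proof
      assume d: "d = 0"
      have const: "w j l = w j 0" if "j \<le> p" "l \<le> k j" for j l
      proof (cases "j = 0")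
        case True
        then have "U l = U 0"
          using affU[of l] that d by simp
        then show ?thesis
          using True by (simp add: U_def)
      next
        case False
        then have "j \<in> {1..p}"
          using that by simp
        from aff[OF this that(2)] d show ?thesis
          by simp
      qed
      have "\<phi> 2 j = \<phi> 1 j" if j: "j \<le> p" for j
      proof -
        let ?n = "k j + 1"
        have two: "(2 :: complex) \<noteq> 0"
          by simp
        note car = Ec[of j] Dc[of 2 j] Fc[OF j] phic[OF j two]
        have "det (\<phi> 2 j) * det (E j) = det (\<phi> 2 j * E j)"
          by (rule det_mult[OF car(4,1), symmetric])
        also have "\<dots> = det (E j) * det (D 2 j)"
          unfolding phiE[OF j two] by (rule det_mult[OF car(1,2)])
        finally have "det (\<phi> 2 j) * det (E j) = det (E j) * det (D 2 j)" .
        moreover have "det (E j) \<noteq> 0"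
          using basis[OF j] by (simp add: is_basis_iff_det E_def)
        ultimately have "det (D 2 j) = 1"
          using phi_det[OF j two] by simp
        then have "(2 :: complex) powi (\<Sum>l<?n. w j l) = 2 powi 0"
          by (simp add: D_def det_weight_mat)
        then have "(\<Sum>l<?n. w j l) = 0"
          by (rule two_powi_inject)
        moreover have "(\<Sum>l<?n. w j l) = (\<Sum>l<?n. w j 0)"
          by (intro sum.cong refl const[OF j]) simp
        ultimately have "w j 0 = 0"
          by simp
        then have "w j l = 0" if "l \<le> k j" for l
          using const[OF j that] by simp
        then have "D 2 j = 1\<^sub>m ?n"
          by (intro eq_matI) (auto simp: D_def less_Suc_eq_le)
        then have "\<phi> 2 j * E j = E j"
          using phiE[OF j two] car(1) by simp
        moreover have "\<phi> 2 j * (E j * F j) = \<phi> 2 j * E j * F j"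
          by (rule assoc_mult_mat[OF car(4,1,3), symmetric])
        ultimately show ?thesis
          using car(4) EF[OF j] phi_one[OF j] by simp
      qed
      then have "cpoly_eval P (\<lambda>(j, r, c). \<phi> 2 j $$ (r, c)) = cpoly_eval P (\<lambda>(j, r, c). \<phi> 1 j $$ (r, c))"
        using Pvars by (intro cpoly_eval_cong) auto
      then show False
        using Peval[of 2] Peval[of 1] by simp
    qed
    have "a i = 0" if i: "i \<in> multi_indices p k" "i 0 \<noteq> (\<Sum>t=1..p. i t)" for i
    proof (rule ccontr)
      assume "a i \<noteq> 0"
      then have "U 0 + d * int (i 0) = (\<Sum>j=1..p. w j (i j))"
        using supp[OF i(1)] affU[of "i 0"] multi_indices_le[OF i(1), of 0] by simp
      also have "\<dots> = (\<Sum>j=1..p. w j 0 + d * int (i j))"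
        using multi_indices_le[OF i(1)] by (intro sum.cong aff) auto
      also have "\<dots> = U 0 + d * int (\<Sum>j=1..p. i j)"
        by (simp add: sum.distrib sum_distrib_left U0)
      finally have "d * int (i 0) = d * int (\<Sum>j=1..p. i j)"
        by (simp only: add_left_cancel)
      then show False
        using \<open>d \<noteq> 0\<close> i(2) by (simp only: mult_cancel_left of_nat_eq_iff simp_thms)
    qed
    moreover have "A = (\<lambda>r. \<Sum>i\<in>multi_indices p k. a i * pure_tensor p k (\<lambda>j. e j (i j)) r)"
      unfolding expansion_eq_tensor_act AE E_def ..
    ultimately show ?thesis
      using basis unfolding diagonalizable_def by blast
  qed
qed

theorem theorem2p5:
  fixes p :: nat and k :: "nat \<Rightarrow> nat" and A :: tensor and Det :: "(nat \<Rightarrow> nat) cpoly"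
  assumes "p \<ge> 2"
    and "k 0 = (\<Sum>i=1..p. k i)"
    and "k 0 \<ge> 1"
    and "A \<in> tensors p k" and "A \<noteq> (\<lambda>i. 0)"
    and "is_hyperdeterminant p k Det"
    and "cpoly_eval Det A \<noteq> 0"
  shows "diagonalizable p k A \<longleftrightarrow> contains_Cstar p k (Stab p k A)"
proof
  assume "diagonalizable p k A"
  with assms(2,3) show "contains_Cstar p k (Stab p k A)"
    by (rule diagonalizable_imp_contains_Cstar)
next
  assume "contains_Cstar p k (Stab p k A)"
  moreover have "A \<notin> segre_dual_variety p k"
    using assms(4,6,7) by (auto simp: is_hyperdeterminant_def)
  ultimately show "diagonalizable p k A"
    using assms(2-5) by (intro contains_Cstar_imp_diagonalizable)
qed

end
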